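(* Let $(d,n,\theta)$ be such that $\theta<1$ and one of the following holds: $d=1$, $n\ge1$, $\theta\in[1-1/(2n),1]$; or $d=2$, $n=1$, $\theta\in(0,1]$; or $d\ge3$, $n=1$, $\theta\in[0,1]$. Let $\{u^{(j)}\}_{j=1}^N\subset l^2(\mathbb{Z}^d)$ be a family of $N$ sequences that are orthonormal with respect to the natural scalar product in $l^2(\mathbb{Z}^d)$, and set $$\rho(k):=\sum_{j=1}^Nu^{(j)}(k)^2,\qquad k\in\mathbb{Z}^d.$$ Then $$\sum_{k\in\mathbb{Z}^d}\rho(k)^{\frac{2-\theta}{1-\theta}}\le\mathrm{K}(\theta)^{\frac1{1-\theta}}\sum_{j=1}^N\|\mathcal{D}^nu^{(j)}\|^2.$$
   Context: Sequences are real-valued; $\|\cdot\|$ is the $l^2$-norm. $\mathrm{D}_iu(k)=u(k+e_i)-u(k)$, $\nabla u=(\mathrm{D}_1u,\dots,\mathrm{D}_du)$, $\|\nabla u\|^2=\sum_i\|\mathrm{D}_iu\|^2$, $-\Delta=\sum_{i=1}^d\mathrm{D}_i^*\mathrm{D}_i$, and $\mathcal{D}^n:=\Delta^{n/2}$ for $n$ even, $\mathcal{D}^n:=\nabla\Delta^{(n-1)/2}$ for $n$ odd. $\mathrm{K}(\theta)=\mathrm{K}(\theta;d,n)$ denotes the sharp (smallest) constant in the inequality $$\sup_{k\in\mathbb{Z}^d}u(k)^2\le\mathrm{K}(\theta)\,\|u\|^{2\theta}\,\|\mathcal{D}^nu\|^{2(1-\theta)}\qquad\text{for all }u\in l^2(\mathbb{Z}^d),$$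 which is finite for the listed $(d,n,\theta)$. *)

theory Defs
  imports "HOL-Analysis.Analysis"
begin

section \<open>Sequences on the lattice\<close>

text \<open>The lattice of dimension \<open>d\<close> is the type \<open>int ^ 'd\<close> with \<open>d = CARD('d)\<close>;
  the basis vector \<open>e\<^sub>i\<close> is \<open>axis i 1\<close>.\<close>

definition l2 :: "('k \<Rightarrow> real) set" where
  "l2 = {u. (\<lambda>k. (u k)\<^sup>2) summable_on UNIV}"

definition l2_inner :: "('k \<Rightarrow> real) \<Rightarrow> ('k \<Rightarrow> real) \<Rightarrow> real" where
  "l2_inner u v = (\<Sum>\<^sub>\<infinity>k. u k * v k)"

definition l2_norm :: "('k \<Rightarrow> real) \<Rightarrow> real" where
  "l2_norm u = sqrt (l2_inner u u)"

definition diff :: "'d \<Rightarrow> (int ^ 'd \<Rightarrow> real) \<Rightarrow> int ^ 'd \<Rightarrow> real" where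
  "diff i u k = u (k + axis i 1) - u k"

text \<open>The formal adjoint of \<^const>\<open>diff\<close>; on square-summable sequences it is the Hilbert space
  adjoint (lemma \<open>l2_inner_diff\<close> below).\<close>

definition diff_adj :: "'d \<Rightarrow> (int ^ 'd \<Rightarrow> real) \<Rightarrow> int ^ 'd \<Rightarrow> real" where
  "diff_adj i u k = u (k - axis i 1) - u k"

definition laplace :: "(int ^ 'd \<Rightarrow> real) \<Rightarrow> int ^ 'd \<Rightarrow> real" where
  "laplace u k = - (\<Sum>i\<in>(UNIV :: 'd::finite set). diff_adj i (diff i u) k)"

definition grad :: "(int ^ 'd \<Rightarrow> real) \<Rightarrow> 'd \<Rightarrow> int ^ 'd \<Rightarrow> real" where
  "grad u = (\<lambda>i. diff i u)"

definition l2_norm_vec :: "('d::finite \<Rightarrow> int ^ 'd \<Rightarrow> real) \<Rightarrow> real" where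
  "l2_norm_vec w = sqrt (\<Sum>i\<in>UNIV. (l2_norm (w i))\<^sup>2)"

text \<open>The norm of \<open>\<D>\<^sup>n u\<close>. As \<open>\<D>\<^sup>n u\<close> is scalar-valued for even \<open>n\<close> and vector-valued
  for odd \<open>n\<close>, only its norm is given a name.\<close>

definition norm_D :: "nat \<Rightarrow> (int ^ 'd::finite \<Rightarrow> real) \<Rightarrow> real" where
  "norm_D n u = (if even n then l2_norm ((laplace ^^ (n div 2)) u)
                 else l2_norm_vec (grad ((laplace ^^ ((n - 1) div 2)) u)))"

section \<open>The sharp constant\<close>

text \<open>The first argument carries the dimension. The convention \<open>0 powr 0 = 0\<close> is harmless:
  for \<open>\<theta> < 1\<close> it matters only at \<open>u = 0\<close>, where both sides vanish anyway.
  The constants admitted in the inequality form a closed set of positive reals, so if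
  there are any, the infimum is the smallest one.\<close>

definition sharp_const :: "'d::finite itself \<Rightarrow> nat \<Rightarrow> real \<Rightarrow> real" where
  "sharp_const _ n \<theta> = Inf {C. \<forall>u \<in> (l2 :: (int ^ 'd \<Rightarrow> real) set).
     (SUP k. (u k)\<^sup>2) \<le> C * l2_norm u powr (2 * \<theta>) * norm_D n u powr (2 * (1 - \<theta>))}"

section \<open>Adjointness\<close>

lemma l2_mult_summable:
  assumes "u \<in> l2" "v \<in> l2"
  shows "(\<lambda>k. u k * v k) summable_on UNIV"
proof -
  have "(\<lambda>k. (u k)\<^sup>2 + (v k)\<^sup>2) summable_on UNIV"
    using assms by (auto simp: l2_def intro: summable_on_add)
  moreover have "norm (u k * v k) \<le> (u k)\<^sup>2 + (v k)\<^sup>2" for k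
    using sum_squares_bound[of "\<bar>u k\<bar>" "\<bar>v k\<bar>"]
      mult_nonneg_nonneg[OF abs_ge_zero[of "u k"] abs_ge_zero[of "v k"]]
    unfolding real_norm_def abs_mult power2_abs by linarith
  ultimately have "(\<lambda>k. norm (u k * v k)) summable_on UNIV"
    by (rule Infinite_Sum.abs_summable_on_comparison_test')
  then show ?thesis
    by (rule abs_summable_summable)
qed

lemma bij_shift: "bij (\<lambda>k :: int ^ 'd. k + a)"
  by (rule bij_betw_byWitness[where f' = "\<lambda>k. k - a"]) auto

lemma l2_shift:
  fixes u :: "int ^ 'd \<Rightarrow> real"
  assumes "u \<in> l2"
  shows "(\<lambda>k. u (k + a)) \<in> l2"
  using assms summable_on_reindex_bij_betw[OF bij_shift[of a], of "\<lambda>k. (u k)\<^sup>2"]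
  by (simp add: l2_def)

lemma l2_inner_diff:
  assumes "u \<in> l2" "v \<in> l2"
  shows "l2_inner (diff i u) v = l2_inner u (diff_adj i v)"
proof -
  let ?e = "axis i (1::int)"
  have s: "(\<lambda>k. u k * v k) summable_on UNIV"
    using assms by (rule l2_mult_summable)
  have s1: "(\<lambda>k. u (k + ?e) * v k) summable_on UNIV"
    by (rule l2_mult_summable[OF l2_shift[OF assms(1)] assms(2)])
  have s2: "(\<lambda>k. u k * v (k - ?e)) summable_on UNIV"
    using l2_mult_summable[OF assms(1) l2_shift[OF assms(2), of "- ?e"]] by simp
  have "(\<Sum>\<^sub>\<infinity>k. u (k + ?e) * v k) = (\<Sum>\<^sub>\<infinity>k. u k * v (k - ?e))"
    using infsum_reindex_bij_betw[OF bij_shift[of ?e], of "\<lambda>k. u k * v (k - ?e)"] by simp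
  then have "(\<Sum>\<^sub>\<infinity>k. u (k + ?e) * v k - u k * v k) =
      (\<Sum>\<^sub>\<infinity>k. u k * v (k - ?e) - u k * v k)"
    using infsum_add[OF s1 summable_on_uminus[THEN iffD2, OF s]]
      infsum_add[OF s2 summable_on_uminus[THEN iffD2, OF s]] by simp
  then show ?thesis
    by (simp add: l2_inner_def diff_def diff_adj_def algebra_simps)
qed

end

theory Submission
  imports Defs "HOL-Real_Asymp.Real_Asymp"
begin

text \<open>
  The pointwise inequality, applied to \<open>v = (\<Sum>j. u\<^sub>j(k) u\<^sub>j)\<close> for a fixed lattice point \<open>k\<close>, has
  \<open>v(k) = \<parallel>v\<parallel>\<^sup>2 = \<rho>(k)\<close> by orthonormality, so it bounds a power of \<open>\<rho>(k)\<close> by the quadratic form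
  \<open>\<parallel>\<D>\<^sup>n v\<parallel>\<^sup>2\<close> in the numbers \<open>u\<^sub>j(k)\<close>; summing over \<open>k\<close> turns this form into its trace.

  The sharp constant being an infimum, one also needs that some constant is admissible. It suffices
  to treat small \<open>\<theta>\<close>, because \<open>\<D>\<^sup>n\<close> is bounded. For \<open>\<theta> = 1 - 1/(2n)\<close> one telescopes \<open>u\<^sup>2\<close> along a
  line and uses that \<open>n \<mapsto> \<parallel>\<D>\<^sup>n u\<parallel>\<close> is log-convex. For \<open>\<theta> = 1/s\<close> and \<open>d \<ge> 2\<close> one iterates the
  Gagliardo-Nirenberg inequality \<open>\<parallel>V\<parallel>\<^sup>2 \<le> \<parallel>D\<^sub>1 V\<parallel>\<^sub>1 \<parallel>D\<^sub>2 V\<parallel>\<^sub>1\<close> in a plane over the powers \<open>V = \<bar>u\<bar>\<^sup>s\<close>.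
  For \<open>\<theta> = 0\<close> and \<open>d \<ge> 3\<close> one tests \<open>-\<Delta>\<close> against \<open>u\<^sup>2/g\<close> with a positive, strictly superharmonic
  function \<open>g\<close>.
\<close>

section \<open>Finite sums of infinite sums\<close>

lemma has_sum_sum_real:
  fixes f :: "'i \<Rightarrow> 'k \<Rightarrow> real"
  assumes "\<And>i. i \<in> I \<Longrightarrow> (f i has_sum S i) A"
  shows "((\<lambda>k. \<Sum>i\<in>I. f i k) has_sum (\<Sum>i\<in>I. S i)) A"
  using assms by (induction I rule: infinite_finite_induct) (auto intro: has_sum_add)

lemma infsum_sum_real:
  fixes f :: "'i \<Rightarrow> 'k \<Rightarrow> real"
  assumes "\<And>i. i \<in> I \<Longrightarrow> f i summable_on A"
  shows "infsum (\<lambda>k. \<Sum>i\<in>I. f i k) A = (\<Sum>i\<in>I. infsum (f i) A)"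
  using has_sum_sum_real[of I f A "\<lambda>i. infsum (f i) A"] assms by (auto intro: infsumI)

section \<open>Square-summable sequences\<close>

lemma l2_cmult: "u \<in> l2 \<Longrightarrow> (\<lambda>k. c * u k) \<in> l2"
  by (auto simp: l2_def power_mult_distrib intro: summable_on_cmult_right)

lemma l2_add:
  assumes "u \<in> l2" "v \<in> l2"
  shows "(\<lambda>k. u k + v k) \<in> l2"
proof -
  have "(\<lambda>k. (u k)\<^sup>2 + (v k)\<^sup>2 + 2 * (u k * v k)) summable_on UNIV"
    using assms l2_mult_summable[OF assms]
    by (auto simp: l2_def intro!: summable_on_add summable_on_cmult_right)
  then show ?thesis
    by (simp add: l2_def power2_sum algebra_simps)
qed

lemma l2_minus: "u \<in> l2 \<Longrightarrow> v \<in> l2 \<Longrightarrow> (\<lambda>k. u k - v k) \<in> l2"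
  using l2_add[of u "\<lambda>k. (-1) * v k"] l2_cmult[of v "-1"] by simp

lemma l2_zero: "(\<lambda>k. 0) \<in> l2"
  by (simp add: l2_def)

lemma l2_sum: "(\<And>i. i \<in> I \<Longrightarrow> f i \<in> l2) \<Longrightarrow> (\<lambda>k. \<Sum>i\<in>I. f i k) \<in> l2"
  by (induction I rule: infinite_finite_induct) (auto intro: l2_add simp: l2_zero)

lemma l2_abs: "u \<in> l2 \<Longrightarrow> (\<lambda>k. \<bar>u k\<bar>) \<in> l2"
  by (simp add: l2_def)

lemma l2_norm_abs: "l2_norm (\<lambda>k. \<bar>u k\<bar>) = l2_norm u"
  by (simp add: l2_norm_def l2_inner_def)

lemma l2_inner_commute: "l2_inner u v = l2_inner v u"
  by (simp add: l2_inner_def mult.commute)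

lemma l2_inner_self_nonneg: "l2_inner u u \<ge> 0"
  unfolding l2_inner_def by (rule infsum_nonneg) simp

lemma l2_norm_nonneg: "l2_norm u \<ge> 0"
  by (simp add: l2_norm_def l2_inner_self_nonneg)

lemma l2_norm_sq: "(l2_norm u)\<^sup>2 = l2_inner u u"
  by (simp add: l2_norm_def l2_inner_self_nonneg)

lemma l2_norm_sq_infsum: "(l2_norm u)\<^sup>2 = (\<Sum>\<^sub>\<infinity>k. (u k)\<^sup>2)"
  unfolding l2_norm_sq l2_inner_def by (simp add: power2_eq_square)

lemma sum_power2_le_l2_norm:
  assumes "u \<in> l2" "finite F"
  shows "(\<Sum>k\<in>F. (u k)\<^sup>2) \<le> (l2_norm u)\<^sup>2"
  using assms unfolding l2_norm_sq_infsum l2_def by (intro finite_sum_le_infsum) auto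

lemma abs_le_l2_norm: "u \<in> l2 \<Longrightarrow> \<bar>u k\<bar> \<le> l2_norm u"
  using sum_power2_le_l2_norm[of u "{k}"] l2_norm_nonneg[of u]
  by (simp add: abs_le_square_iff[symmetric])

text \<open>Cauchy-Schwarz: a weighted arithmetic-geometric mean inequality is summed termwise, with
  weights chosen so that each of the two sums contributes half of the product of the norms.\<close>

lemma l2_inner_le_norm:
  assumes "u \<in> l2" "v \<in> l2"
  shows "l2_inner u v \<le> l2_norm u * l2_norm v"
proof (cases "l2_norm u = 0 \<or> l2_norm v = 0")
  case True
  then have "u k * v k = 0" for k
    using abs_le_l2_norm[OF assms(1), of k] abs_le_l2_norm[OF assms(2), of k] by auto
  then have "l2_inner u v = 0"
    unfolding l2_inner_def by (intro infsum_0) blast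
  then show ?thesis
    by (simp add: l2_norm_nonneg)
next
  case False
  define a b where "a = l2_norm u" and "b = l2_norm v"
  have pos: "a > 0" "b > 0"
    using False l2_norm_nonneg[of u] l2_norm_nonneg[of v] by (auto simp: a_def b_def)
  have s: "(\<lambda>k. (u k)\<^sup>2) summable_on UNIV" "(\<lambda>k. (v k)\<^sup>2) summable_on UNIV"
    using assms by (auto simp: l2_def)
  have "l2_inner u v \<le> (\<Sum>\<^sub>\<infinity>k. (b / (2 * a)) * (u k)\<^sup>2 + (a / (2 * b)) * (v k)\<^sup>2)"
    unfolding l2_inner_def
  proof (rule infsum_mono)
    fix k
    have "0 \<le> (b * u k - a * v k)\<^sup>2"
      by simp
    then show "u k * v k \<le> (b / (2 * a)) * (u k)\<^sup>2 + (a / (2 * b)) * (v k)\<^sup>2"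
      using pos by (simp add: field_simps power2_eq_square)
  qed (intro l2_mult_summable summable_on_add summable_on_cmult_right s assms)+
  also have "\<dots> = (b / (2 * a)) * a\<^sup>2 + (a / (2 * b)) * b\<^sup>2"
    unfolding a_def b_def l2_norm_sq_infsum
    by (simp only: infsum_add summable_on_cmult_right s infsum_cmult_right')
  also have "\<dots> = a * b"
    using pos by (simp add: power2_eq_square)
  finally show ?thesis
    by (simp add: a_def b_def)
qed

lemma l2_norm_shift:
  fixes u :: "int ^ 'd \<Rightarrow> real"
  shows "l2_norm (\<lambda>k. u (k + a)) = l2_norm u"
  using infsum_reindex_bij_betw[OF bij_shift[of a], of "\<lambda>k. u k * u k"]
  by (simp add: l2_norm_def l2_inner_def)

text \<open>Dropping terms can only decrease a sum of squares. This restricts a sequence to a line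
  or a plane through a given point, with \<open>h\<close> the parametrization.\<close>

lemma l2_reindex:
  assumes "u \<in> l2" "inj h"
  shows "(\<lambda>k. u (h k)) \<in> l2" "l2_norm (\<lambda>k. u (h k)) \<le> l2_norm u"
proof -
  have s: "(\<lambda>k. (u k)\<^sup>2) summable_on range h"
    using assms(1) by (auto simp: l2_def intro: summable_on_subset)
  then show "(\<lambda>k. u (h k)) \<in> l2"
    using summable_on_reindex[OF assms(2), of "\<lambda>k. (u k)\<^sup>2"] by (simp add: l2_def o_def)
  have "(\<Sum>\<^sub>\<infinity>k. (u (h k))\<^sup>2) = infsum (\<lambda>k. (u k)\<^sup>2) (range h)"
    using infsum_reindex[OF assms(2), of "\<lambda>k. (u k)\<^sup>2"] by (simp add: o_def)
  also have "\<dots> \<le> (\<Sum>\<^sub>\<infinity>k. (u k)\<^sup>2)"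
    using s assms(1) by (intro infsum_mono2) (auto simp: l2_def)
  finally show "l2_norm (\<lambda>k. u (h k)) \<le> l2_norm u"
    using l2_norm_nonneg by (auto simp: l2_norm_sq_infsum[symmetric] intro: power2_le_imp_le)
qed

section \<open>Difference operators\<close>

lemma l2_diff: "u \<in> l2 \<Longrightarrow> diff i u \<in> l2"
  unfolding diff_def by (intro l2_minus l2_shift)

lemma l2_diff_adj: "u \<in> l2 \<Longrightarrow> diff_adj i u \<in> l2"
  using l2_minus[OF l2_shift[of u "- axis i 1"], of u] by (simp add: diff_adj_def[abs_def])

lemma l2_laplace: "u \<in> l2 \<Longrightarrow> laplace u \<in> l2"
proof -
  assume "u \<in> l2"
  then have "(\<lambda>k. (-1) * (\<Sum>i\<in>UNIV. diff_adj i (diff i u) k)) \<in> l2"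
    by (intro l2_cmult l2_sum l2_diff_adj l2_diff)
  then show ?thesis
    by (simp add: laplace_def[abs_def])
qed

lemma l2_laplace_power: "u \<in> l2 \<Longrightarrow> (laplace ^^ m) u \<in> l2"
  by (induction m) (auto intro: l2_laplace)

lemma l2_norm_vec_L2_set: "l2_norm_vec w = L2_set (\<lambda>i. l2_norm (w i)) UNIV"
  by (simp add: l2_norm_vec_def L2_set_def)

lemma l2_norm_vec_nonneg: "l2_norm_vec w \<ge> 0"
  by (simp add: l2_norm_vec_L2_set)

lemma l2_norm_vec_sq: "(l2_norm_vec w)\<^sup>2 = (\<Sum>i\<in>UNIV. (l2_norm (w i))\<^sup>2)"
  by (simp add: l2_norm_vec_def sum_nonneg)

lemma l2_norm_diff_le_grad: "l2_norm (diff i u) \<le> l2_norm_vec (grad u)"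
proof -
  have "(l2_norm (diff i u))\<^sup>2 \<le> (l2_norm_vec (grad u))\<^sup>2"
    unfolding l2_norm_vec_sq grad_def
    by (rule member_le_sum[where f = "\<lambda>i. (l2_norm (diff i u))\<^sup>2"]) auto
  then show ?thesis
    using l2_norm_vec_nonneg by (rule power2_le_imp_le)
qed

lemma grad_inner_le:
  assumes "v \<in> l2" "w \<in> l2"
  shows "(\<Sum>i\<in>UNIV. l2_inner (diff i v) (diff i w)) \<le> l2_norm_vec (grad v) * l2_norm_vec (grad w)"
proof -
  have "(\<Sum>i\<in>UNIV. l2_inner (diff i v) (diff i w))
      \<le> (\<Sum>i\<in>UNIV. \<bar>l2_norm (diff i v)\<bar> * \<bar>l2_norm (diff i w)\<bar>)"
    using assms by (intro sum_mono) (simp add: l2_norm_nonneg l2_inner_le_norm l2_diff)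
  also have "\<dots> \<le> l2_norm_vec (grad v) * l2_norm_vec (grad w)"
    unfolding l2_norm_vec_L2_set grad_def by (rule L2_set_mult_ineq)
  finally show ?thesis .
qed

lemma laplace_eq: "laplace u k = - (\<Sum>i\<in>UNIV. 2 * u k - u (k + axis i 1) - u (k - axis i 1))"
  by (simp add: laplace_def diff_adj_def diff_def algebra_simps)

text \<open>Summation by parts, with the adjointness of \<open>diff\<close> and
  \<open>diff_adj\<close> used in each coordinate direction.\<close>

lemma grad_inner_eq_laplace:
  assumes "v \<in> l2" "w \<in> l2"
  shows "(\<Sum>i\<in>UNIV. l2_inner (diff i v) (diff i w)) = - l2_inner v (laplace w)"
proof -
  have "(\<Sum>i\<in>UNIV. l2_inner (diff i v) (diff i w))
      = (\<Sum>i\<in>UNIV. l2_inner v (diff_adj i (diff i w)))"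
    using assms by (simp add: l2_inner_diff l2_diff)
  also have "\<dots> = (\<Sum>\<^sub>\<infinity>k. \<Sum>i\<in>UNIV. v k * diff_adj i (diff i w) k)"
    unfolding l2_inner_def
    using assms by (intro infsum_sum_real[symmetric] l2_mult_summable l2_diff_adj l2_diff)
  also have "\<dots> = (\<Sum>\<^sub>\<infinity>k. - (v k * laplace w k))"
    by (simp add: laplace_def sum_distrib_left)
  finally show ?thesis
    by (simp add: l2_inner_def infsum_uminus)
qed

section \<open>Norms of iterated differences\<close>

lemma norm_D_nonneg: "norm_D n u \<ge> 0"
  by (simp add: norm_D_def l2_norm_nonneg l2_norm_vec_nonneg)

lemma norm_D_0: "norm_D 0 u = l2_norm u"
  by (simp add: norm_D_def)

lemma norm_D_1: "norm_D 1 u = l2_norm_vec (grad u)"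
  by (simp add: norm_D_def)

lemma norm_D_laplace: "norm_D n ((laplace ^^ m) u) = norm_D (n + 2 * m) u"
proof -
  have "(laplace ^^ i) ((laplace ^^ m) u) = (laplace ^^ (i + m)) u" for i
    by (simp add: funpow_add)
  moreover have "(n - 1) div 2 + m = (n + 2 * m - 1) div 2" if "odd n"
    using that by (cases n) auto
  ultimately show ?thesis
    by (auto simp: norm_D_def)
qed

lemma norm_D_Suc_Suc: "norm_D (Suc (Suc n)) u = norm_D n (laplace u)"
  using norm_D_laplace[of n 1 u] by simp

text \<open>Summation by parts moves one difference from one factor to the other, and Cauchy-Schwarz
  separates the factors. This is carried out for \<open>n = 0\<close> and \<open>n = 1\<close>; the
  case \<open>Suc (Suc m)\<close> for \<open>u\<close> is the case \<open>m\<close> for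
  \<open>laplace u\<close>.\<close>

lemma norm_D_log_convex:
  assumes "u \<in> l2"
  shows "(norm_D (Suc n) u)\<^sup>2 \<le> norm_D n u * norm_D (Suc (Suc n)) u"
  using assms
proof (induction n arbitrary: u rule: nat_less_induct)
  case (1 n)
  consider "n = 0" | "n = 1" | m where "n = Suc (Suc m)"
    by (metis One_nat_def not0_implies_Suc)
  then show ?case
  proof cases
    case 1
    \<comment> \<open>The sign is put into the argument because \<open>l2_inner_le_norm\<close>
      bounds the inner product itself and not its absolute value.\<close>
    have "(l2_norm_vec (grad u))\<^sup>2 = l2_inner (\<lambda>k. (-1) * u k) (laplace u)"
      using grad_inner_eq_laplace[OF \<open>u \<in> l2\<close> \<open>u \<in> l2\<close>]
      by (simp add: l2_norm_vec_sq grad_def l2_norm_sq l2_inner_def infsum_uminus)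
    also have "\<dots> \<le> l2_norm (\<lambda>k. (-1) * u k) * l2_norm (laplace u)"
      using \<open>u \<in> l2\<close> by (intro l2_inner_le_norm l2_cmult l2_laplace)
    also have "l2_norm (\<lambda>k. (-1) * u k) = l2_norm u"
      by (simp add: l2_norm_def l2_inner_def)
    finally show ?thesis
      using 1 by (simp add: norm_D_def)
  next
    case 2
    have "(l2_norm (laplace u))\<^sup>2 = - l2_inner (laplace u) (\<lambda>k. (-1) * laplace u k)"
      by (simp add: l2_norm_sq l2_inner_def infsum_uminus)
    also have "\<dots> = - l2_inner (\<lambda>k. (-1) * laplace u k) (laplace u)"
      by (simp add: l2_inner_commute)
    also have "\<dots> = (\<Sum>i\<in>UNIV. l2_inner (diff i (\<lambda>k. (-1) * laplace u k)) (diff i u))"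
      using \<open>u \<in> l2\<close> by (intro grad_inner_eq_laplace[symmetric] l2_cmult l2_laplace)
    also have "\<dots> \<le> l2_norm_vec (grad (\<lambda>k. (-1) * laplace u k)) * l2_norm_vec (grad u)"
      using \<open>u \<in> l2\<close> by (intro grad_inner_le l2_cmult l2_laplace)
    also have "l2_norm_vec (grad (\<lambda>k. (-1) * laplace u k)) = l2_norm_vec (grad (laplace u))"
      by (simp add: l2_norm_vec_def grad_def l2_norm_def l2_inner_def diff_def algebra_simps)
    finally show ?thesis
      using 2 by (simp add: norm_D_def mult.commute)
  next
    case 3
    then show ?thesis
      using "1.IH"[rule_format, of m "laplace u"] \<open>u \<in> l2\<close> by (simp add: norm_D_Suc_Suc l2_laplace)
  qed
qed

lemma norm_D_1_le:
  fixes u :: "int ^ 'd::finite \<Rightarrow> real"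
  assumes "u \<in> l2"
  shows "norm_D 1 u \<le> 2 * real CARD('d) * l2_norm u"
proof -
  have "l2_norm (diff i u) \<le> 2 * l2_norm u" for i
  proof -
    have "(l2_norm (diff i u))\<^sup>2 \<le> (\<Sum>\<^sub>\<infinity>k. 2 * (u (k + axis i 1))\<^sup>2 + 2 * (u k)\<^sup>2)"
      unfolding l2_norm_sq_infsum
    proof (rule infsum_mono)
      fix k
      have "0 \<le> (u (k + axis i 1) + u k)\<^sup>2"
        by simp
      then show "(diff i u k)\<^sup>2 \<le> 2 * (u (k + axis i 1))\<^sup>2 + 2 * (u k)\<^sup>2"
        by (simp add: diff_def power2_eq_square algebra_simps)
    qed (use assms l2_diff[OF assms, of i] l2_shift[OF assms, of "axis i 1"] in
        \<open>auto simp: l2_def intro!: summable_on_add summable_on_cmult_right\<close>)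
    also have "\<dots> = 2 * (l2_norm (\<lambda>k. u (k + axis i 1)))\<^sup>2 + 2 * (l2_norm u)\<^sup>2"
      using assms l2_shift[OF assms, of "axis i 1"] unfolding l2_norm_sq_infsum l2_def
      by (subst infsum_add) (auto simp: infsum_cmult_right' intro: summable_on_cmult_right)
    also have "\<dots> = (2 * l2_norm u)\<^sup>2"
      by (simp add: l2_norm_shift power_mult_distrib)
    finally show ?thesis
      by (rule power2_le_imp_le) (simp add: l2_norm_nonneg)
  qed
  then have "(\<Sum>i\<in>(UNIV::'d set). l2_norm (diff i u)) \<le> real CARD('d) * (2 * l2_norm u)"
    by (intro sum_bounded_above) auto
  moreover have "norm_D 1 u \<le> (\<Sum>i\<in>UNIV. l2_norm (diff i u))"
    unfolding norm_D_1 l2_norm_vec_L2_set grad_def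
    by (rule L2_set_le_sum) (simp add: l2_norm_nonneg)
  ultimately show ?thesis
    by simp
qed

text \<open>Passing to \<open>laplace u\<close> lowers \<open>n\<close> by two, so even
  \<open>n\<close> reduces to the bound for a single gradient. Odd \<open>n\<close> reduces to
  comparing \<open>laplace u\<close> with the gradient of \<open>u\<close>, which log-convexity
  settles.\<close>

lemma norm_D_Suc_le:
  fixes u :: "int ^ 'd::finite \<Rightarrow> real"
  assumes "u \<in> l2"
  shows "norm_D (Suc n) u \<le> 2 * real CARD('d) * norm_D n u"
  using assms
proof (induction n arbitrary: u rule: nat_less_induct)
  case (1 n)
  consider "n = 0" | "n = 1" | m where "n = Suc (Suc m)"
    by (metis One_nat_def not0_implies_Suc)
  then show ?case
  proof cases
    case 1
    then show ?thesis
      using norm_D_1_le[OF \<open>u \<in> l2\<close>] by (simp add: norm_D_0)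
  next
    case 2
    let ?c = "2 * real CARD('d)"
    \<comment> \<open>Log-convexity brings in the gradient of \<open>laplace u\<close>, which is at
      most \<open>?c\<close> times \<open>norm_D 2 u\<close>; one factor \<open>norm_D 2 u\<close>
      then cancels.\<close>
    have "(norm_D 2 u)\<^sup>2 \<le> norm_D 1 u * norm_D 1 (laplace u)"
      using norm_D_log_convex[OF \<open>u \<in> l2\<close>, of 1] norm_D_Suc_Suc[of 1 u] by (simp add: numeral_2_eq_2)
    also have "\<dots> \<le> norm_D 1 u * (?c * norm_D 2 u)"
      using norm_D_1_le[OF l2_laplace[OF \<open>u \<in> l2\<close>]] norm_D_Suc_Suc[of 0 u]
      by (intro mult_left_mono norm_D_nonneg) (simp add: norm_D_0 numeral_2_eq_2)
    finally have "norm_D 2 u * norm_D 2 u \<le> (?c * norm_D 1 u) * norm_D 2 u"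
      by (simp add: power2_eq_square algebra_simps)
    then have "norm_D 2 u \<le> ?c * norm_D 1 u"
      using norm_D_nonneg[of 2 u] norm_D_nonneg[of 1 u]
      by (cases "norm_D 2 u = 0") (auto simp: mult_le_cancel_right)
    then show ?thesis
      using 2 by (simp add: numeral_2_eq_2)
  next
    case 3
    then show ?thesis
      using "1.IH"[rule_format, of m "laplace u"] \<open>u \<in> l2\<close> by (simp add: norm_D_Suc_Suc l2_laplace)
  qed
qed

lemma norm_D_le:
  fixes u :: "int ^ 'd::finite \<Rightarrow> real"
  assumes "u \<in> l2"
  shows "norm_D n u \<le> (2 * real CARD('d)) ^ n * l2_norm u"
proof (induction n)
  case 0
  then show ?case
    by (simp add: norm_D_0)
next
  case (Suc n)
  have "norm_D (Suc n) u \<le> 2 * real CARD('d) * norm_D n u"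
    by (rule norm_D_Suc_le[OF assms])
  also have "\<dots> \<le> 2 * real CARD('d) * ((2 * real CARD('d)) ^ n * l2_norm u)"
    using Suc by (intro mult_left_mono) auto
  finally show ?case
    by (simp add: mult.assoc)
qed

text \<open>Log-convexity makes the ratios of successive norms nondecreasing, so the quotient of the
  \<open>n\<close>-th and the zeroth norm dominates the \<open>n\<close>-th power of the first
  ratio.\<close>

lemma norm_D_interpolation:
  assumes "u \<in> l2" "n \<ge> 1"
  shows "norm_D 1 u ^ n \<le> l2_norm u ^ (n - 1) * norm_D n u"
proof -
  \<comment> \<open>The first ratio is at most every later one, written without division since norms
    may vanish.\<close>
  have step: "norm_D 1 u * norm_D m u \<le> l2_norm u * norm_D (Suc m) u" for m
  proof (induction m)
    case 0
    then show ?case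
      by (simp add: norm_D_0)
  next
    case (Suc m)
    let ?a = "\<lambda>j. norm_D j u"
    show ?case
    proof (cases "?a (Suc m) = 0")
      case True
      then show ?thesis
        by (simp add: l2_norm_nonneg norm_D_nonneg)
    next
      case False
      then have pos: "?a (Suc m) > 0" "?a m > 0"
        using norm_D_log_convex[OF assms(1), of m] norm_D_nonneg[of m u] norm_D_nonneg[of "Suc m" u]
        by (auto simp: less_le)
      \<comment> \<open>Multiply the induction hypothesis by log-convexity; the common factor
        \<open>?a m * ?a (Suc m)\<close> cancels.\<close>
      have "?a 1 * ?a m * (?a (Suc m))\<^sup>2 \<le> l2_norm u * ?a (Suc m) * (?a m * ?a (Suc (Suc m)))"
        by (intro mult_mono[OF Suc norm_D_log_convex[OF assms(1), of m]])
          (auto intro!: mult_nonneg_nonneg simp: l2_norm_nonneg norm_D_nonneg)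
      then have "(?a 1 * ?a (Suc m)) * (?a m * ?a (Suc m))
          \<le> (l2_norm u * ?a (Suc (Suc m))) * (?a m * ?a (Suc m))"
        by (simp add: power2_eq_square mult_ac)
      then show ?thesis
        using pos by (simp add: mult_le_cancel_right)
    qed
  qed
  have "norm_D 1 u ^ Suc m \<le> l2_norm u ^ m * norm_D (Suc m) u" for m
  proof (induction m)
    case 0
    then show ?case
      by simp
  next
    case (Suc m)
    have "norm_D 1 u ^ Suc (Suc m) \<le> norm_D 1 u * (l2_norm u ^ m * norm_D (Suc m) u)"
      using Suc by (simp only: power_Suc[of _ "Suc m"]) (intro mult_left_mono norm_D_nonneg)
    also have "\<dots> = l2_norm u ^ m * (norm_D 1 u * norm_D (Suc m) u)"
      by (simp add: mult_ac)
    also have "\<dots> \<le> l2_norm u ^ m * (l2_norm u * norm_D (Suc (Suc m)) u)"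
      by (intro mult_left_mono step) (simp add: l2_norm_nonneg)
    finally show ?case
      by (simp add: mult_ac)
  qed
  from this[of "n - 1"] assms(2) show ?thesis
    by simp
qed

section \<open>Sums along lines and planes\<close>

lemma summable_on_increments:
  fixes V :: "'k \<Rightarrow> real"
  assumes "V summable_on UNIV" "bij h"
  shows "(\<lambda>k. \<bar>V (h k) - V k\<bar>) summable_on UNIV"
proof -
  have "(\<lambda>k. V (h k)) summable_on UNIV"
    using summable_on_reindex_bij_betw[OF assms(2), of V] assms(1) by blast
  moreover have "(\<lambda>k. - V k) summable_on UNIV"
    using assms(1) by (rule summable_on_uminus[THEN iffD2])
  ultimately have "(\<lambda>k. V (h k) + - V k) summable_on UNIV"
    by (rule summable_on_add)
  then show ?thesis
    using summable_on_iff_abs_summable_on_real[THEN iffD1] by fastforce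
qed

text \<open>Telescoping from \<open>x\<close> to the right: the value at the far end tends to 0
  because \<open>w\<close> is summable.\<close>

lemma abs_le_infsum_increments:
  fixes w :: "int \<Rightarrow> real"
  assumes w: "w summable_on UNIV"
  shows "\<bar>w x\<bar> \<le> (\<Sum>\<^sub>\<infinity>t. \<bar>w (t + 1) - w t\<bar>)"
proof -
  define S where "S = (\<Sum>\<^sub>\<infinity>t. \<bar>w (t + 1) - w t\<bar>)"
  have bij: "bij (\<lambda>t::int. t + 1)"
    by (rule bij_betw_byWitness[where f' = "\<lambda>t. t - 1"]) auto
  have s: "(\<lambda>t. \<bar>w (t + 1) - w t\<bar>) summable_on UNIV"
    by (rule summable_on_increments[OF w bij])
  have "\<bar>w x\<bar> \<le> \<bar>w (x + int n)\<bar> + S" for n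
  proof -
    have "w (x + int n) - w x = (\<Sum>j<n. w (x + int j + 1) - w (x + int j))"
      by (induction n) (auto simp: algebra_simps)
    then have "\<bar>w x\<bar> \<le> \<bar>w (x + int n)\<bar> + (\<Sum>j<n. \<bar>w (x + int j + 1) - w (x + int j)\<bar>)"
      using sum_abs[of "\<lambda>j. w (x + int j + 1) - w (x + int j)" "{..<n}"] by linarith
    also have "(\<Sum>j<n. \<bar>w (x + int j + 1) - w (x + int j)\<bar>)
        = (\<Sum>t\<in>(\<lambda>j. x + int j) ` {..<n}. \<bar>w (t + 1) - w t\<bar>)"
      by (subst sum.reindex) (auto simp: inj_on_def)
    also have "\<dots> \<le> S"
      unfolding S_def using s by (intro finite_sum_le_infsum) auto
    finally show ?thesis
      by simp
  qed
  moreover have "(\<lambda>n. \<bar>w (x + int n)\<bar> + S) \<longlonglongrightarrow> \<bar>0\<bar> + S"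
  proof (intro tendsto_add tendsto_rabs tendsto_const)
    have "w summable_on range (\<lambda>n. x + int n)"
      using w by (rule summable_on_subset) simp
    then have "(\<lambda>n. w (x + int n)) summable_on UNIV"
      using summable_on_reindex[of "\<lambda>n. x + int n" UNIV w] by (auto simp: inj_on_def o_def)
    then show "(\<lambda>n. w (x + int n)) \<longlonglongrightarrow> 0"
      by (intro summable_LIMSEQ_zero summable_on_imp_summable)
  qed
  ultimately show ?thesis
    using LIMSEQ_le_const[of "\<lambda>n. \<bar>w (x + int n)\<bar> + S" "\<bar>0\<bar> + S" "\<bar>w x\<bar>"] by (auto simp: S_def)
qed

section \<open>Powers of sequences and their increments\<close>

lemma l2_power:
  assumes "U \<in> l2" "s \<ge> 1"
  shows "(\<lambda>k. \<bar>U k\<bar> ^ s) \<in> l2"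
proof -
  obtain m where m: "s = Suc m"
    using assms(2) by (cases s) auto
  have "(\<lambda>k. (l2_norm U ^ m)\<^sup>2 * (U k)\<^sup>2) summable_on UNIV"
    using assms(1) by (auto simp: l2_def intro: summable_on_cmult_right)
  \<comment> \<open>All factors but one are bounded by the norm.\<close>
  moreover have "(\<bar>U k\<bar> ^ s)\<^sup>2 \<le> (l2_norm U ^ m)\<^sup>2 * (U k)\<^sup>2" for k
  proof -
    have "\<bar>U k\<bar> ^ s \<le> l2_norm U ^ m * \<bar>U k\<bar>"
      using abs_le_l2_norm[OF assms(1), of k] unfolding m power_Suc2
      by (intro mult_right_mono power_mono) auto
    then have "(\<bar>U k\<bar> ^ s)\<^sup>2 \<le> (l2_norm U ^ m * \<bar>U k\<bar>)\<^sup>2"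
      by (intro power_mono) auto
    then show ?thesis
      by (simp add: power_mult_distrib)
  qed
  ultimately show ?thesis
    unfolding l2_def by (auto intro: summable_on_comparison_test)
qed

text \<open>Factor out \<open>a - b\<close>: each of the \<open>Suc s\<close> remaining products is
  at most the larger of \<open>a ^ s\<close> and \<open>b ^ s\<close>. Their sum replaces the
  maximum so that the bound later splits into two inner products.\<close>

lemma abs_power_diff_le:
  fixes a b :: real
  assumes "a \<ge> 0" "b \<ge> 0"
  shows "\<bar>a ^ Suc s - b ^ Suc s\<bar> \<le> real (Suc s) * (\<bar>a - b\<bar> * (a ^ s + b ^ s))"
proof -
  have "a ^ p * b ^ (s - p) \<le> a ^ s + b ^ s" if "p < Suc s" for p
  proof -
    have "a ^ p * b ^ (s - p) \<le> max a b ^ p * max a b ^ (s - p)"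
      using assms by (intro mult_mono power_mono) auto
    also have "\<dots> = max a b ^ s"
      using that by (simp add: power_add[symmetric])
    also have "\<dots> \<le> a ^ s + b ^ s"
      using assms by (auto simp: max_def)
    finally show ?thesis .
  qed
  then have "(\<Sum>p<Suc s. a ^ p * b ^ (s - p)) \<le> real (Suc s) * (a ^ s + b ^ s)"
    using sum_bounded_above[of "{..<Suc s}" "\<lambda>p. a ^ p * b ^ (s - p)" "a ^ s + b ^ s"] by simp
  moreover have "(\<Sum>p<Suc s. a ^ p * b ^ (s - p)) \<ge> 0"
    using assms by (intro sum_nonneg) auto
  moreover have "a ^ Suc s - b ^ Suc s = (a - b) * (\<Sum>p<Suc s. a ^ p * b ^ (s - p))"
    using power_diff_sumr2[of a "Suc s" b] by (simp only: diff_Suc_Suc mult.commute)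
  ultimately have "\<bar>a ^ Suc s - b ^ Suc s\<bar> \<le> \<bar>a - b\<bar> * (real (Suc s) * (a ^ s + b ^ s))"
    by (simp only: abs_mult abs_of_nonneg) (intro mult_left_mono, auto)
  then show ?thesis
    by (simp only: mult_ac)
qed

text \<open>A discrete chain rule followed by Cauchy-Schwarz. The factor 2 comes from the values at
  \<open>k\<close> and at \<open>h k\<close>, the latter having no larger norm since
  \<open>h\<close> is injective. Leaving \<open>h\<close> open serves lines and both directions of a
  plane.\<close>

lemma infsum_power_increments_le:
  fixes U :: "'k \<Rightarrow> real"
  assumes U: "U \<in> l2" and h: "inj h" and s: "s \<ge> 1"
  shows "(\<Sum>\<^sub>\<infinity>k. \<bar>\<bar>U (h k)\<bar> ^ Suc s - \<bar>U k\<bar> ^ Suc s\<bar>)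
      \<le> 2 * real (Suc s) * l2_norm (\<lambda>k. U (h k) - U k) * l2_norm (\<lambda>k. \<bar>U k\<bar> ^ s)"
proof -
  let ?D = "\<lambda>k. \<bar>U (h k) - U k\<bar>" and ?W = "\<lambda>k. \<bar>U k\<bar> ^ s"
  have D: "?D \<in> l2" "l2_norm ?D = l2_norm (\<lambda>k. U (h k) - U k)"
    using U l2_reindex[OF U h] by (auto simp: l2_norm_abs intro!: l2_abs l2_minus)
  have W: "?W \<in> l2" "(\<lambda>k. ?W (h k)) \<in> l2" "l2_norm (\<lambda>k. ?W (h k)) \<le> l2_norm ?W"
    using l2_power[OF U s] l2_reindex[OF l2_power[OF U s] h] by auto
  have sum: "(\<lambda>k. ?D k * ?W (h k)) summable_on UNIV" "(\<lambda>k. ?D k * ?W k) summable_on UNIV"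
    using D W by (auto intro: l2_mult_summable)
  let ?R = "\<lambda>k. real (Suc s) * (?D k * ?W (h k) + ?D k * ?W k)"
  have R: "?R summable_on UNIV"
    using sum by (intro summable_on_cmult_right summable_on_add)
  have le: "\<bar>\<bar>U (h k)\<bar> ^ Suc s - \<bar>U k\<bar> ^ Suc s\<bar> \<le> ?R k" for k
  proof -
    have "\<bar>\<bar>U (h k)\<bar> ^ Suc s - \<bar>U k\<bar> ^ Suc s\<bar>
        \<le> real (Suc s) * (\<bar>\<bar>U (h k)\<bar> - \<bar>U k\<bar>\<bar> * (?W (h k) + ?W k))"
      by (rule abs_power_diff_le) auto
    also have "\<dots> \<le> real (Suc s) * (?D k * (?W (h k) + ?W k))"
      by (intro mult_left_mono mult_right_mono abs_triangle_ineq3) auto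
    finally show ?thesis
      by (simp only: distrib_left)
  qed
  have "(\<Sum>\<^sub>\<infinity>k. \<bar>\<bar>U (h k)\<bar> ^ Suc s - \<bar>U k\<bar> ^ Suc s\<bar>) \<le> infsum ?R UNIV"
    by (intro infsum_mono R le summable_on_comparison_test[OF R]) auto
  also have "\<dots> = real (Suc s) * (l2_inner ?D (\<lambda>k. ?W (h k)) + l2_inner ?D ?W)"
    using sum by (simp add: infsum_cmult_right' infsum_add l2_inner_def)
  also have "\<dots> \<le> real (Suc s) * (l2_norm ?D * l2_norm ?W + l2_norm ?D * l2_norm ?W)"
  proof (intro mult_left_mono add_mono)
    show "l2_inner ?D (\<lambda>k. ?W (h k)) \<le> l2_norm ?D * l2_norm ?W"
      using l2_inner_le_norm[OF D(1) W(2)] mult_left_mono[OF W(3) l2_norm_nonneg[of ?D]] by linarith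
    show "l2_inner ?D ?W \<le> l2_norm ?D * l2_norm ?W"
      by (rule l2_inner_le_norm[OF D(1) W(1)])
  qed auto
  finally show ?thesis
    by (simp add: D(2) algebra_simps)
qed

section \<open>The bound along a line\<close>

lemma axis_add: "axis i (x + y) = axis i x + (axis i y :: 'a::monoid_add ^ 'd)"
  by (simp add: axis_def vec_eq_iff)

text \<open>Telescope the square of \<open>u\<close> along the line through \<open>k\<close> in
  direction \<open>i\<close> and bound its increments by the chain rule above; 4 is
  \<open>2 * real (Suc s)\<close> at \<open>s = 1\<close>.\<close>

lemma power2_le_norm_diff:
  fixes u :: "int ^ 'd::finite \<Rightarrow> real"
  assumes u: "u \<in> l2"
  shows "(u k)\<^sup>2 \<le> 4 * l2_norm u * l2_norm (diff i u)"
proof -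
  define U where "U = (\<lambda>t. u (k + axis i t))"
  have inj: "inj (\<lambda>t. k + axis i t)"
    by (auto simp: inj_def axis_eq_axis)
  have U: "U \<in> l2" "l2_norm U \<le> l2_norm u"
    using l2_reindex[OF u inj] by (auto simp: U_def)
  have D: "(\<lambda>t. U (t + 1) - U t) = (\<lambda>t. diff i u (k + axis i t))"
    by (auto simp: U_def diff_def axis_add add.assoc)
  have ND: "l2_norm (\<lambda>t. U (t + 1) - U t) \<le> l2_norm (diff i u)"
    unfolding D by (rule l2_reindex[OF l2_diff[OF u] inj])
  \<comment> \<open>Squares are written with exponent \<open>Suc 1\<close> to fit the shape of
    \<open>infsum_power_increments_le\<close>.\<close>
  have "(\<lambda>t. \<bar>U t\<bar> ^ Suc 1) summable_on UNIV"
    using U(1) by (simp add: l2_def power2_eq_square)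
  then have "\<bar>\<bar>U 0\<bar> ^ Suc 1\<bar> \<le> (\<Sum>\<^sub>\<infinity>t. \<bar>\<bar>U (t + 1)\<bar> ^ Suc 1 - \<bar>U t\<bar> ^ Suc 1\<bar>)"
    by (rule abs_le_infsum_increments)
  also have "\<dots> \<le> 2 * real (Suc 1) * l2_norm (\<lambda>t. U (t + 1) - U t) * l2_norm (\<lambda>t. \<bar>U t\<bar> ^ 1)"
    using U(1) by (intro infsum_power_increments_le) (auto simp: inj_def)
  also have "\<dots> = 4 * l2_norm (\<lambda>t. U (t + 1) - U t) * l2_norm U"
    by (simp add: l2_norm_abs)
  also have "\<dots> \<le> 4 * l2_norm (diff i u) * l2_norm u"
    using ND U(2) by (intro mult_mono) (auto simp: l2_norm_nonneg)
  finally show ?thesis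
    by (simp add: U_def axis_def zero_vec_def[symmetric] power2_eq_square mult_ac)
qed

section \<open>A Gagliardo-Nirenberg inequality in the plane\<close>

text \<open>The variation \<open>h x\<close> along the vertical line over \<open>x\<close> bounds
  \<open>V\<close> on that whole line, and by Fubini its sum over \<open>x\<close> is the sum of all
  vertical increments.\<close>

lemma fibre_increments:
  fixes V :: "'a \<times> int \<Rightarrow> real"
  assumes V: "V summable_on UNIV"
  defines "h \<equiv> \<lambda>x. \<Sum>\<^sub>\<infinity>y. \<bar>V (x, y + 1) - V (x, y)\<bar>"
  shows "\<bar>V (x, y)\<bar> \<le> h x" "h summable_on UNIV"
    "infsum h UNIV = (\<Sum>\<^sub>\<infinity>p. \<bar>V (fst p, snd p + 1) - V p\<bar>)"
proof -
  have V': "(\<lambda>(x, y). V (x, y)) summable_on UNIV \<times> UNIV"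
    using V by simp
  show "\<bar>V (x, y)\<bar> \<le> h x"
    unfolding h_def using summable_on_SigmaD1[OF V', of x] by (intro abs_le_infsum_increments) simp
  have bij: "bij (\<lambda>p::'a \<times> int. (fst p, snd p + 1))"
    by (rule bij_betw_byWitness[where f' = "\<lambda>p. (fst p, snd p - 1)"]) auto
  have "(\<lambda>p. \<bar>V (fst p, snd p + 1) - V p\<bar>) summable_on UNIV"
    by (rule summable_on_increments[OF V bij])
  then have D': "(\<lambda>(x, y). \<bar>V (x, y + 1) - V (x, y)\<bar>) summable_on UNIV \<times> UNIV"
    by (simp add: case_prod_unfold)
  show "h summable_on UNIV"
    unfolding h_def by (rule summable_on_Sigma_banach[OF D'])
  show "infsum h UNIV = (\<Sum>\<^sub>\<infinity>p. \<bar>V (fst p, snd p + 1) - V p\<bar>)"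
    unfolding h_def using infsum_Sigma'_banach[OF D'] by (simp add: case_prod_unfold)
qed

text \<open>One factor \<open>\<bar>V\<bar>\<close> is bounded by the variation along the vertical
  line and the other by that along the horizontal line. The result is a function of \<open>x\<close>
  times a function of \<open>y\<close>, which sums separately.\<close>

lemma plane_Gagliardo_Nirenberg:
  fixes V :: "int \<times> int \<Rightarrow> real"
  assumes V: "V summable_on UNIV" and V2: "V \<in> l2"
  shows "(\<Sum>\<^sub>\<infinity>p. (V p)\<^sup>2) \<le> (\<Sum>\<^sub>\<infinity>p. \<bar>V (fst p + 1, snd p) - V p\<bar>)
    * (\<Sum>\<^sub>\<infinity>p. \<bar>V (fst p, snd p + 1) - V p\<bar>)"
proof -
  \<comment> \<open>\<open>W\<close> swaps the coordinates, so that the fibre lemma also yields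
    horizontal lines.\<close>
  define W where "W = (\<lambda>p. V (snd p, fst p))"
  have bij: "bij (\<lambda>p::int \<times> int. (snd p, fst p))"
    by (rule bij_betw_byWitness[where f' = "\<lambda>p. (snd p, fst p)"]) auto
  have W: "W summable_on UNIV"
    using V summable_on_reindex_bij_betw[OF bij, of V] by (simp add: W_def)
  define h where "h x = (\<Sum>\<^sub>\<infinity>y. \<bar>V (x, y + 1) - V (x, y)\<bar>)" for x
  define f where "f y = (\<Sum>\<^sub>\<infinity>x. \<bar>W (y, x + 1) - W (y, x)\<bar>)" for y
  note h = fibre_increments[OF V, folded h_def]
  note f = fibre_increments[OF W, folded f_def]
  have nn: "h x \<ge> 0" "f x \<ge> 0" for x
    by (auto simp: h_def f_def intro: infsum_nonneg)
  have "(\<Sum>\<^sub>\<infinity>p. (V p)\<^sup>2) \<le> infsum f UNIV * infsum h UNIV"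
  proof (rule infsum_le_finite_sums)
    show "(\<lambda>p. (V p)\<^sup>2) summable_on UNIV"
      using V2 by (simp add: l2_def)
    fix F :: "(int \<times> int) set" assume F: "finite F"
    \<comment> \<open>Enlarging \<open>F\<close> to the product of its projections makes the sum
      factor.\<close>
    have "(\<Sum>p\<in>F. (V p)\<^sup>2) \<le> (\<Sum>p\<in>fst ` F \<times> snd ` F. h (fst p) * f (snd p))"
    proof (rule order_trans[OF sum_mono sum_mono2])
      fix p :: "int \<times> int"
      have "\<bar>V p\<bar> * \<bar>V p\<bar> \<le> h (fst p) * f (snd p)"
        using h(1)[of "fst p" "snd p"] f(1)[of "snd p" "fst p"] nn
        by (intro mult_mono) (auto simp: W_def)
      then show "(V p)\<^sup>2 \<le> h (fst p) * f (snd p)"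
        by (simp add: power2_eq_square)
    qed (use F nn in \<open>auto simp: subset_fst_snd\<close>)
    also have "\<dots> = (\<Sum>x\<in>fst ` F. h x) * (\<Sum>y\<in>snd ` F. f y)"
      by (simp add: sum_product sum.cartesian_product case_prod_beta)
    also have "\<dots> \<le> infsum h UNIV * infsum f UNIV"
      using h(2) f(2) nn F
      by (intro mult_mono finite_sum_le_infsum) (auto intro: sum_nonneg infsum_nonneg)
    finally show "(\<Sum>p\<in>F. (V p)\<^sup>2) \<le> infsum f UNIV * infsum h UNIV"
      by (simp add: mult.commute)
  qed
  moreover have "infsum f UNIV = (\<Sum>\<^sub>\<infinity>p. \<bar>V (fst p + 1, snd p) - V p\<bar>)"
    unfolding f(3) using infsum_reindex_bij_betw[OF bij, of "\<lambda>p. \<bar>V (fst p + 1, snd p) - V p\<bar>"]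
    by (simp add: W_def)
  ultimately show ?thesis
    by (simp add: h(3))
qed

text \<open>The plane inequality for \<open>V = \<bar>U\<bar> ^ Suc (Suc m)\<close> lowers the power
  by one: in each direction the increments of \<open>V\<close> cost one difference of
  \<open>U\<close> and one norm of \<open>\<bar>U\<bar> ^ Suc m\<close>. Each step thus gains one
  product of the two difference norms.\<close>

lemma plane_power_bound:
  shows "\<exists>C\<ge>0. \<forall>U::int \<times> int \<Rightarrow> real. U \<in> l2 \<longrightarrow> (l2_norm (\<lambda>p. \<bar>U p\<bar> ^ Suc m))\<^sup>2
    \<le> C * (l2_norm (\<lambda>p. U (fst p + 1, snd p) - U p) * l2_norm (\<lambda>p. U (fst p, snd p + 1) - U p)) ^ m
      * (l2_norm U)\<^sup>2"
proof (induction m)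
  case 0
  show ?case
    by (intro exI[of _ 1]) (simp add: l2_norm_abs)
next
  case (Suc m)
  then obtain C where C: "C \<ge> 0" and IH: "\<And>U::int \<times> int \<Rightarrow> real. U \<in> l2 \<Longrightarrow>
      (l2_norm (\<lambda>p. \<bar>U p\<bar> ^ Suc m))\<^sup>2
    \<le> C * (l2_norm (\<lambda>p. U (fst p + 1, snd p) - U p) * l2_norm (\<lambda>p. U (fst p, snd p + 1) - U p)) ^ m
      * (l2_norm U)\<^sup>2"
    by blast
  show ?case
  proof (intro exI conjI allI impI)
    let ?c = "2 * real (Suc (Suc m))"
    show "?c\<^sup>2 * C \<ge> 0"
      using C by simp
    fix U :: "int \<times> int \<Rightarrow> real" assume U: "U \<in> l2"
    define V where "V = (\<lambda>p. \<bar>U p\<bar> ^ Suc (Suc m))"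
    let ?W = "\<lambda>p. \<bar>U p\<bar> ^ Suc m"
    define a where "a = l2_norm (\<lambda>p. U (fst p + 1, snd p) - U p)"
    define b where "b = l2_norm (\<lambda>p. U (fst p, snd p + 1) - U p)"
    have V: "V summable_on UNIV"
      using l2_mult_summable[OF l2_abs[OF U] l2_power[OF U, of "Suc m"]] by (simp add: V_def)
    have V2: "V \<in> l2"
      unfolding V_def by (intro l2_power U) simp
    have inj: "inj (\<lambda>p::int \<times> int. (fst p + 1, snd p))" "inj (\<lambda>p::int \<times> int. (fst p, snd p + 1))"
      by (auto simp: inj_def)
    have 1: "(\<Sum>\<^sub>\<infinity>p. \<bar>V (fst p + 1, snd p) - V p\<bar>) \<le> ?c * a * l2_norm ?W"
      using infsum_power_increments_le[OF U inj(1), of "Suc m"] by (simp only: V_def a_def)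
    have 2: "(\<Sum>\<^sub>\<infinity>p. \<bar>V (fst p, snd p + 1) - V p\<bar>) \<le> ?c * b * l2_norm ?W"
      using infsum_power_increments_le[OF U inj(2), of "Suc m"] by (simp only: V_def b_def)
    have nn: "a \<ge> 0" "b \<ge> 0"
      by (auto simp: a_def b_def l2_norm_nonneg)
    have "(l2_norm V)\<^sup>2 \<le> (?c * a * l2_norm ?W) * (?c * b * l2_norm ?W)"
      unfolding l2_norm_sq_infsum
      by (rule order_trans[OF plane_Gagliardo_Nirenberg[OF V V2] mult_mono[OF 1 2]])
        (use nn in \<open>auto intro!: infsum_nonneg mult_nonneg_nonneg simp: l2_norm_nonneg\<close>)
    also have "\<dots> = ?c\<^sup>2 * (a * b) * (l2_norm ?W)\<^sup>2"
      by (simp only: power2_eq_square mult_ac)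
    also have "\<dots> \<le> ?c\<^sup>2 * (a * b) * (C * (a * b) ^ m * (l2_norm U)\<^sup>2)"
      using nn IH[OF U] by (intro mult_left_mono) (auto simp: a_def b_def)
    finally show "(l2_norm (\<lambda>p. \<bar>U p\<bar> ^ Suc (Suc m)))\<^sup>2 \<le> ?c\<^sup>2 * C * (l2_norm (\<lambda>p. U (fst p + 1, snd p) - U p)
       * l2_norm (\<lambda>p. U (fst p, snd p + 1) - U p)) ^ Suc m * (l2_norm U)\<^sup>2"
      by (simp add: V_def a_def b_def mult_ac)
  qed
qed

text \<open>The plane bound is applied on the section through \<open>k\<close> spanned by two
  distinct axes; a single value of \<open>\<bar>u\<bar> ^ Suc m\<close> is at most its norm
  there.\<close>

lemma grad_power_bound:
  assumes "CARD('d::finite) \<ge> 2"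
  shows "\<exists>C\<ge>0. \<forall>u::int ^ 'd \<Rightarrow> real. u \<in> l2 \<longrightarrow>
    (\<forall>k. (u k)\<^sup>2 ^ Suc m \<le> C * (l2_norm u) ^ 2 * (norm_D 1 u) ^ (2 * m))"
proof -
  obtain i1 i2 :: 'd where ne: "i1 \<noteq> i2"
    using assms card_le_Suc0_iff_eq[of "UNIV :: 'd set"] by auto
  obtain C where C: "C \<ge> 0" and bound: "\<And>U::int \<times> int \<Rightarrow> real. U \<in> l2 \<Longrightarrow>
      (l2_norm (\<lambda>p. \<bar>U p\<bar> ^ Suc m))\<^sup>2
    \<le> C * (l2_norm (\<lambda>p. U (fst p + 1, snd p) - U p) * l2_norm (\<lambda>p. U (fst p, snd p + 1) - U p)) ^ m
      * (l2_norm U)\<^sup>2"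
    using plane_power_bound[of m] by blast
  have "(u k)\<^sup>2 ^ Suc m \<le> C * (l2_norm u) ^ 2 * (norm_D 1 u) ^ (2 * m)"
    if u: "u \<in> l2" for u :: "int ^ 'd \<Rightarrow> real" and k
  proof -
    define h :: "int \<times> int \<Rightarrow> int ^ 'd" where "h = (\<lambda>p. k + axis i1 (fst p) + axis i2 (snd p))"
    define U where "U = (\<lambda>p. u (h p))"
    have h_nth: "h p $ i1 = k $ i1 + fst p" "h p $ i2 = k $ i2 + snd p" for p
      using ne by (auto simp: h_def axis_def)
    have inj: "inj h"
    proof (rule injI)
      fix p q assume "h p = h q"
      then have "h p $ i1 = h q $ i1" "h p $ i2 = h q $ i2"
        by simp_all
      then show "p = q"
        by (simp add: h_nth prod_eq_iff)
    qed
    have U: "U \<in> l2" "l2_norm U \<le> l2_norm u"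
      using l2_reindex[OF u inj] by (auto simp: U_def)
    have "(\<lambda>p. U (fst p + 1, snd p) - U p) = (\<lambda>p. diff i1 u (h p))"
      "(\<lambda>p. U (fst p, snd p + 1) - U p) = (\<lambda>p. diff i2 u (h p))"
      by (auto simp: U_def h_def diff_def axis_add add_ac)
    then have D: "l2_norm (\<lambda>p. U (fst p + 1, snd p) - U p) \<le> norm_D 1 u"
      "l2_norm (\<lambda>p. U (fst p, snd p + 1) - U p) \<le> norm_D 1 u"
      using l2_reindex(2)[OF l2_diff[OF u] inj] l2_norm_diff_le_grad[of _ u]
      unfolding norm_D_1 by (auto intro: order_trans)
    have "h (0, 0) = k"
      by (simp add: h_def axis_def vec_eq_iff)
    then have "(u k)\<^sup>2 ^ Suc m = \<bar>\<bar>U (0, 0)\<bar> ^ Suc m\<bar>\<^sup>2"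
      by (simp add: U_def power_mult[symmetric] power_even_abs mult.commute del: power_Suc)
    also have "\<dots> \<le> (l2_norm (\<lambda>p. \<bar>U p\<bar> ^ Suc m))\<^sup>2"
      using abs_le_l2_norm[OF l2_power[OF U(1), of "Suc m"], of "(0, 0)"] by (intro power_mono) auto
    also have "\<dots> \<le> C * (l2_norm (\<lambda>p. U (fst p + 1, snd p) - U p)
        * l2_norm (\<lambda>p. U (fst p, snd p + 1) - U p)) ^ m * (l2_norm U)\<^sup>2"
      by (rule bound[OF U(1)])
    also have "\<dots> \<le> C * (norm_D 1 u * norm_D 1 u) ^ m * (l2_norm u)\<^sup>2"
      using C D U(2)
      by (intro mult_mono power_mono) (auto intro!: mult_nonneg_nonneg simp: l2_norm_nonneg norm_D_nonneg)
    also have "\<dots> = C * (l2_norm u) ^ 2 * (norm_D 1 u) ^ (2 * m)"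
      by (simp add: power_mult power_mult_distrib power2_eq_square mult_ac)
    finally show ?thesis .
  qed
  then show ?thesis
    using C by blast
qed

section \<open>Positive superharmonic functions\<close>

text \<open>A Picone-type inequality: on each edge the squared difference of \<open>u\<close>
  dominates \<open>u(k+e)^2 (1 - g(k)/g(k+e)) + u(k)^2 (1 - g(k+e)/g(k))\<close>. Summing over all
  edges collects \<open>- laplace g k / g k\<close> in front of \<open>(u k)^2\<close>. The bound
  \<open>M\<close> on the ratios makes the separate sums converge.\<close>

lemma superharmonic_bound:
  fixes g u :: "int ^ 'd::finite \<Rightarrow> real"
  assumes u: "u \<in> l2" and g: "\<And>k. g k > 0"
    and M: "\<And>k i. g (k + axis i 1) \<le> M * g k" "\<And>k i. g (k - axis i 1) \<le> M * g k"
    and super: "\<And>k. laplace g k \<le> 0"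
  shows "- laplace g k / g k * (u k)\<^sup>2 \<le> (norm_D 1 u)\<^sup>2"
proof -
  define r where "r = (\<lambda>i k. g (k - axis i 1) / g k)"
  define q where "q = (\<lambda>i k. g (k + axis i 1) / g k)"
  define S where "S = (\<Sum>\<^sub>\<infinity>k. (u k)\<^sup>2)"
  define R where "R = (\<lambda>i. \<Sum>\<^sub>\<infinity>k. r i k * (u k)\<^sup>2)"
  define Q where "Q = (\<lambda>i. \<Sum>\<^sub>\<infinity>k. q i k * (u k)\<^sup>2)"
  have rq: "0 \<le> r i k" "r i k \<le> M" "0 \<le> q i k" "q i k \<le> M" for i k
    using g[of k] g[of "k - axis i 1"] g[of "k + axis i 1"] M[of k i]
    by (auto simp: r_def q_def divide_le_eq)
  have S: "((\<lambda>k. (u k)\<^sup>2) has_sum S) UNIV"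
    using u by (simp add: l2_def S_def)
  then have sM: "(\<lambda>k. M * (u k)\<^sup>2) summable_on UNIV"
    by (intro summable_on_cmult_right) (auto simp: summable_on_def)
  have R: "((\<lambda>k. r i k * (u k)\<^sup>2) has_sum R i) UNIV" for i
    unfolding R_def using rq
    by (intro has_sum_infsum summable_on_comparison_test[OF sM]) (auto intro: mult_right_mono)
  have Q: "((\<lambda>k. q i k * (u k)\<^sup>2) has_sum Q i) UNIV" for i
    unfolding Q_def using rq
    by (intro has_sum_infsum summable_on_comparison_test[OF sM]) (auto intro: mult_right_mono)
  have le: "2 * S - R i - Q i \<le> (l2_norm (diff i u))\<^sup>2" for i
  proof -
    let ?e = "axis i 1 :: int ^ 'd"
    have Ss: "((\<lambda>k. (u (k + ?e))\<^sup>2) has_sum S) UNIV"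
      using has_sum_reindex_bij_betw[OF bij_shift[of ?e], of "\<lambda>k. (u k)\<^sup>2" S] S by simp
    \<comment> \<open>The shift attaches the backward ratio at \<open>k + ?e\<close> to the edge
      from \<open>k\<close> to \<open>k + ?e\<close>.\<close>
    have Rs: "((\<lambda>k. r i (k + ?e) * (u (k + ?e))\<^sup>2) has_sum R i) UNIV"
      using has_sum_reindex_bij_betw[OF bij_shift[of ?e], of "\<lambda>k. r i k * (u k)\<^sup>2" "R i"] R[of i] by simp
    have lhs: "((\<lambda>k. ((u (k + ?e))\<^sup>2 + (u k)\<^sup>2) + (- (r i (k + ?e) * (u (k + ?e))\<^sup>2) + - (q i k * (u k)\<^sup>2)))
        has_sum (S + S) + (- R i + - Q i)) UNIV"
      using S Ss Rs Q by (intro has_sum_add has_sum_uminusI)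
    have rhs: "((\<lambda>k. (diff i u k)\<^sup>2) has_sum (l2_norm (diff i u))\<^sup>2) UNIV"
      using l2_diff[OF u, of i] by (simp add: l2_norm_sq_infsum l2_def)
    have "(S + S) + (- R i + - Q i) \<le> (l2_norm (diff i u))\<^sup>2"
    proof (rule has_sum_mono[OF lhs rhs])
      fix k
      let ?a = "u (k + ?e)" and ?b = "u k" and ?A = "g (k + ?e)" and ?B = "g k"
      have pos: "?A > 0" "?B > 0"
        by (auto simp: g)
      \<comment> \<open>This square is the defect in the edge inequality.\<close>
      have "0 \<le> (?B * ?a - ?A * ?b)\<^sup>2 / (?A * ?B)"
        using pos by (intro divide_nonneg_pos) auto
      also have "\<dots> = ?B / ?A * ?a\<^sup>2 + ?A / ?B * ?b\<^sup>2 - 2 * ?a * ?b"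
        using pos by (simp add: field_simps power2_eq_square)
      finally show "(?a\<^sup>2 + ?b\<^sup>2) + (- (r i (k + ?e) * ?a\<^sup>2) + - (q i k * ?b\<^sup>2)) \<le> (diff i u k)\<^sup>2"
        by (simp add: r_def q_def diff_def power2_diff)
    qed
    then show ?thesis
      by simp
  qed
  have eq: "(\<Sum>i\<in>UNIV. 2 * (u k)\<^sup>2 + (- (r i k * (u k)\<^sup>2) + - (q i k * (u k)\<^sup>2)))
      = - laplace g k / g k * (u k)\<^sup>2" for k
  proof -
    have "2 * (u k)\<^sup>2 + (- (r i k * (u k)\<^sup>2) + - (q i k * (u k)\<^sup>2))
        = (2 * g k - g (k + axis i 1) - g (k - axis i 1)) / g k * (u k)\<^sup>2" for i
      using g[of k] by (simp add: r_def q_def field_simps)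
    then show ?thesis
      by (simp add: laplace_eq sum_distrib_right sum_divide_distrib)
  qed
  have "((\<lambda>k. \<Sum>i\<in>UNIV. 2 * (u k)\<^sup>2 + (- (r i k * (u k)\<^sup>2) + - (q i k * (u k)\<^sup>2)))
      has_sum (\<Sum>i\<in>UNIV. 2 * S + (- R i + - Q i))) UNIV"
    using S R Q by (intro has_sum_sum_real has_sum_add has_sum_uminusI has_sum_cmult_right)
  then have "((\<lambda>k. - laplace g k / g k * (u k)\<^sup>2) has_sum (\<Sum>i\<in>UNIV. 2 * S - R i - Q i)) UNIV"
    unfolding eq by (simp add: algebra_simps)
  moreover have "- laplace g k / g k * (u k)\<^sup>2 \<ge> 0" for k
    using super[of k] g[of k] by (intro mult_nonneg_nonneg divide_nonneg_pos) auto
  \<comment> \<open>Superharmonicity makes every summand nonnegative, so the sum may be cut down to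
    the single point \<open>k\<close>.\<close>
  ultimately have "(\<Sum>k\<in>{k}. - laplace g k / g k * (u k)\<^sup>2) \<le> (\<Sum>i\<in>UNIV. 2 * S - R i - Q i)"
    by (intro finite_sum_le_has_sum) auto
  also have "\<dots> \<le> (\<Sum>i\<in>UNIV. (l2_norm (diff i u))\<^sup>2)"
    by (intro sum_mono le)
  finally show ?thesis
    unfolding norm_D_1 l2_norm_vec_sq grad_def by simp
qed

text \<open>The Taylor coefficient of the square of \<open>t\<close> is \<open>5/32 = 10/64\<close>,
  and the excess absorbs the remainder near 0. The coefficient has to stay below
  \<open>12/64\<close> for the count at \<open>d = 3\<close> in
  \<open>superharmonic_exists\<close>.\<close>

lemma powr_quarter_bound:
  obtains \<tau> :: real where "\<tau> > 0" "\<tau> \<le> 1 / 2"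
    "\<And>t. \<bar>t\<bar> \<le> \<tau> \<Longrightarrow> (1 + t) powr (- 1 / 4) \<le> 1 - t / 4 + 11 / 64 * t\<^sup>2"
proof -
  have "eventually (\<lambda>t::real. (1 + t) powr (- 1 / 4) \<le> 1 - t / 4 + 11 / 64 * t\<^sup>2) (at_right 0)"
    by real_asymp
  moreover have "eventually (\<lambda>t::real. (1 + t) powr (- 1 / 4) \<le> 1 - t / 4 + 11 / 64 * t\<^sup>2) (at_left 0)"
    by real_asymp
  ultimately have "eventually (\<lambda>t::real. (1 + t) powr (- 1 / 4) \<le> 1 - t / 4 + 11 / 64 * t\<^sup>2) (at 0)"
    by (simp add: eventually_at_split)
  then obtain d where d: "d > 0"
    "\<And>t::real. t \<noteq> 0 \<Longrightarrow> \<bar>t\<bar> < d \<Longrightarrow> (1 + t) powr (- 1 / 4) \<le> 1 - t / 4 + 11 / 64 * t\<^sup>2"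
    by (auto simp: eventually_at dist_real_def)
  show ?thesis
  \<comment> \<open>Half of \<open>d\<close> ensures \<open>\<bar>t\<bar> < d\<close>. The limit
    says nothing about \<open>t = 0\<close>, where equality holds.\<close>
  proof (rule that[of "min (d / 2) (1 / 2)"])
    fix t :: real assume "\<bar>t\<bar> \<le> min (d / 2) (1 / 2)"
    then show "(1 + t) powr (- 1 / 4) \<le> 1 - t / 4 + 11 / 64 * t\<^sup>2"
      using d by (cases "t = 0") auto
  qed (use d in auto)
qed

text \<open>For \<open>d \<ge> 3\<close> the function \<open>(a + \<bar>k\<bar>\<^sup>2) powr (-p)\<close> is superharmonic for large \<open>a\<close> as soon
  as \<open>2 * (p + 1) < d\<close>; the choice \<open>p = 1 / 4\<close> serves all these dimensions.\<close>

lemma superharmonic_exists: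
  assumes d3: "CARD('d::finite) \<ge> 3"
  shows "\<exists>(g :: int ^ 'd \<Rightarrow> real) M. (\<forall>k. g k > 0) \<and> (\<forall>k i. g (k + axis i 1) \<le> M * g k)
    \<and> (\<forall>k i. g (k - axis i 1) \<le> M * g k) \<and> (\<forall>k. laplace g k < 0)"
proof -
  obtain \<tau> :: real where \<tau>: "\<tau> > 0" "\<tau> \<le> 1 / 2"
    "\<And>t. \<bar>t\<bar> \<le> \<tau> \<Longrightarrow> (1 + t) powr (- 1 / 4) \<le> 1 - t / 4 + 11 / 64 * t\<^sup>2"
    by (rule powr_quarter_bound) blast
  \<comment> \<open>The second value keeps the relative increments of \<open>R\<close> at most
    \<open>\<tau>\<close> in modulus; the value 9 makes the final bound negative, as
    \<open>11/32 < 9/24\<close>.\<close>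
  define a where "a = max 9 (9 / \<tau>\<^sup>2)"
  define s :: "int ^ 'd \<Rightarrow> real" where "s = (\<lambda>k. \<Sum>j\<in>UNIV. (real_of_int (k $ j))\<^sup>2)"
  define R where "R = (\<lambda>k. a + s k)"
  define g where "g = (\<lambda>k. R k powr (- 1 / 4))"
  have s0: "s k \<ge> 0" for k
    by (simp add: s_def sum_nonneg)
  have R: "R k \<ge> 9" "R k \<ge> 9 / \<tau>\<^sup>2" "s k \<le> R k" for k
    using s0[of k] by (auto simp: R_def a_def)
  have gpos: "g k > 0" for k
    using R(1)[of k] by (simp add: g_def)
  have s_step: "s (k + axis i e) = s k + (2 * real_of_int e * real_of_int (k $ i) + (real_of_int e)\<^sup>2)" for k i e
  proof -
    have "s (k + axis i e) = (\<Sum>j\<in>UNIV. (real_of_int (k $ j))\<^sup>2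
        + (if j = i then 2 * real_of_int e * real_of_int (k $ i) + (real_of_int e)\<^sup>2 else 0))"
      unfolding s_def by (intro sum.cong) (auto simp: axis_def power2_sum)
    then show ?thesis
      by (simp add: sum.distrib s_def)
  qed
  \<comment> \<open>\<open>t\<close> is the relative increment of \<open>R\<close> along the edge,
    so \<open>g\<close> is multiplied by \<open>(1 + t) powr (- 1 / 4)\<close>.\<close>
  have step: "g (k + axis i e) \<le> g k * (1 - t / 4 + 11 / 64 * t\<^sup>2) \<and> \<bar>t\<bar> \<le> 1 / 2"
    if e: "e = 1 \<or> e = -1" and t: "t = (1 + 2 * real_of_int e * real_of_int (k $ i)) / R k" for k i e t
  proof -
    define y where "y = real_of_int e * real_of_int (k $ i)"
    have Rpos: "R k > 0"
      using R(1)[of k] by simp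
    have "y\<^sup>2 = (real_of_int (k $ i))\<^sup>2"
      using e by (auto simp: y_def)
    also have "\<dots> \<le> s k"
      unfolding s_def by (rule member_le_sum[where f = "\<lambda>j. (real_of_int (k $ j))\<^sup>2"]) auto
    finally have "y\<^sup>2 \<le> R k"
      using R(3)[of k] by linarith
    moreover have "(1 + 2 * y)\<^sup>2 \<le> 3 + 6 * y\<^sup>2"
      using zero_le_power2[of "y - 1"] by (simp add: power2_eq_square algebra_simps)
    ultimately have "(1 + 2 * y)\<^sup>2 \<le> 9 * R k"
      using R(1)[of k] by linarith
    then have "t\<^sup>2 \<le> 9 * R k / (R k)\<^sup>2"
      unfolding t y_def power_divide by (intro divide_right_mono) (auto simp: mult.assoc)
    also have "\<dots> = 9 / R k"
      using Rpos by (simp add: power2_eq_square)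
    also have "\<dots> \<le> \<tau>\<^sup>2"
      using R(2)[of k] Rpos \<tau>(1) by (simp add: field_simps)
    finally have t_le: "\<bar>t\<bar> \<le> \<tau>"
      using \<tau>(1) by (metis abs_le_square_iff abs_of_pos)
    have "R (k + axis i e) = R k * (1 + t)"
      using e Rpos by (auto simp: R_def s_step t field_simps)
    then have "g (k + axis i e) = g k * (1 + t) powr (- 1 / 4)"
      using Rpos t_le \<tau>(2) by (simp add: g_def powr_mult)
    also have "\<dots> \<le> g k * (1 - t / 4 + 11 / 64 * t\<^sup>2)"
      using gpos[of k] by (intro mult_left_mono \<tau>(3) t_le) auto
    finally show ?thesis
      using t_le \<tau>(2) by auto
  qed
  have neg: "axis i (-1 :: int) = - axis i 1" for i :: 'd
    by (simp add: axis_def vec_eq_iff)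
  \<comment> \<open>For \<open>\<bar>t\<bar> \<le> 1/2\<close> the Taylor bound stays below 2, which
    gives the growth constant \<open>M = 2\<close>.\<close>
  have g2: "g (k + axis i e) \<le> 2 * g k" if "e = 1 \<or> e = -1" for k i e
  proof -
    define t where "t = (1 + 2 * real_of_int e * real_of_int (k $ i)) / R k"
    note st = step[OF that t_def]
    then have "t\<^sup>2 \<le> (1 / 2)\<^sup>2"
      by (metis abs_le_square_iff abs_of_pos half_gt_zero_iff zero_less_one)
    then have "1 - t / 4 + 11 / 64 * t\<^sup>2 \<le> 2"
      using conjunct2[OF st] by (simp add: power2_eq_square)
    then have "g k * (1 - t / 4 + 11 / 64 * t\<^sup>2) \<le> g k * 2"
      using gpos[of k] by (intro mult_left_mono) auto
    then show ?thesis
      using st by linarith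
  qed
  have "laplace g k < 0" for k
  proof -
    define d where "d = real CARD('d)"
    have Rpos: "R k > 0"
      using R(1)[of k] by simp
    have term_le: "- (2 * g k - g (k + axis i 1) - g (k - axis i 1))
        \<le> g k / (R k)\<^sup>2 * (- R k / 2 + 11 / 32 + 11 / 8 * (real_of_int (k $ i))\<^sup>2)" for i
    proof -
      define y where "y = real_of_int (k $ i)"
      define t1 where "t1 = (1 + 2 * y) / R k"
      define t2 where "t2 = (1 - 2 * y) / R k"
      have "g (k + axis i 1) \<le> g k * (1 - t1 / 4 + 11 / 64 * t1\<^sup>2)"
        using step[of 1 t1 k i] by (simp add: t1_def y_def)
      moreover have "g (k - axis i 1) \<le> g k * (1 - t2 / 4 + 11 / 64 * t2\<^sup>2)"
        using step[of "-1" t2 k i] by (simp add: t2_def y_def neg)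
      ultimately have "- (2 * g k - g (k + axis i 1) - g (k - axis i 1))
          \<le> g k * (- (t1 + t2) / 4 + 11 / 64 * (t1\<^sup>2 + t2\<^sup>2))"
        by (simp add: algebra_simps add_divide_distrib diff_divide_distrib)
      \<comment> \<open>The terms of first order in \<open>y\<close> cancel between opposite
        neighbours.\<close>
      also have "- (t1 + t2) / 4 + 11 / 64 * (t1\<^sup>2 + t2\<^sup>2)
          = (- R k / 2 + 11 / 32 + 11 / 8 * y\<^sup>2) / (R k)\<^sup>2"
        using Rpos by (simp add: t1_def t2_def field_simps power2_eq_square)
      finally show ?thesis
        by (simp add: y_def)
    qed
    have "laplace g k = (\<Sum>i\<in>UNIV. - (2 * g k - g (k + axis i 1) - g (k - axis i 1)))"
      unfolding laplace_eq sum_negf ..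
    also have "\<dots> \<le> (\<Sum>i\<in>UNIV. g k / (R k)\<^sup>2 * (- R k / 2 + 11 / 32 + 11 / 8 * (real_of_int (k $ i))\<^sup>2))"
      by (intro sum_mono term_le)
    also have "\<dots> = g k / (R k)\<^sup>2 * (d * (- R k / 2 + 11 / 32) + 11 / 8 * s k)"
      by (simp only: sum_distrib_left[symmetric] sum.distrib s_def d_def sum_constant distrib_left)
    also have "\<dots> < 0"
    proof (rule mult_pos_neg)
      \<comment> \<open>Here \<open>d \<ge> 3\<close> enters: \<open>11/8 = 3 * 11/24\<close> and
        \<open>11/24 < 1/2\<close>, which leaves \<open>- R k / 24\<close> per dimension.\<close>
      have "11 / 8 * s k \<le> 11 / 8 * R k"
        using R(3)[of k] by simp
      also have "\<dots> \<le> d * (11 / 24 * R k)"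
        using d3 Rpos mult_right_mono[of 3 d "R k"] by (simp add: d_def)
      finally have "d * (- R k / 2 + 11 / 32) + 11 / 8 * s k \<le> d * (11 / 32 - R k / 24)"
        by (simp add: algebra_simps)
      also have "\<dots> < 0"
        using d3 R(1)[of k] by (intro mult_pos_neg) (auto simp: d_def)
      finally show "d * (- R k / 2 + 11 / 32) + 11 / 8 * s k < 0" .
    qed (use gpos Rpos in auto)
    finally show ?thesis .
  qed
  then show ?thesis
    using gpos g2[of 1] g2[of "-1"] by (intro exI[of _ g] exI[of _ 2]) (auto simp: neg)
qed

text \<open>By translation invariance it suffices to bound the value at the origin, where
  \<open>superharmonic_bound\<close> supplies one fixed positive constant.\<close>

lemma grad_bound:
  assumes d3: "CARD('d::finite) \<ge> 3"
  shows "\<exists>C\<ge>0. \<forall>u::int ^ 'd \<Rightarrow> real. u \<in> l2 \<longrightarrow> (\<forall>k. (u k)\<^sup>2 \<le> C * (norm_D 1 u)\<^sup>2)"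
proof -
  obtain g :: "int ^ 'd \<Rightarrow> real" and M where g: "\<And>k. g k > 0" "\<And>k i. g (k + axis i 1) \<le> M * g k"
    "\<And>k i. g (k - axis i 1) \<le> M * g k" "\<And>k. laplace g k < 0"
    using superharmonic_exists[OF d3] by blast
  define c where "c = - laplace g 0 / g 0"
  have c: "c > 0"
    using g(1,4)[of 0] by (simp add: c_def divide_neg_pos)
  have "(u k)\<^sup>2 \<le> 1 / c * (norm_D 1 u)\<^sup>2" if u: "u \<in> l2" for u :: "int ^ 'd \<Rightarrow> real" and k
  proof -
    define v where "v = (\<lambda>j. u (j + k))"
    have v: "v \<in> l2"
      unfolding v_def by (rule l2_shift[OF u])
    have "diff i v = (\<lambda>j. diff i u (j + k))" for i
      by (auto simp: diff_def v_def add_ac)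
    then have "norm_D 1 v = norm_D 1 u"
      unfolding norm_D_1 l2_norm_vec_def grad_def by (simp add: l2_norm_shift)
    moreover have "c * (v 0)\<^sup>2 \<le> (norm_D 1 v)\<^sup>2"
      unfolding c_def using superharmonic_bound[OF v g(1,2,3)] g(4) by (simp add: less_imp_le)
    ultimately show ?thesis
      using c by (simp add: v_def field_simps)
  qed
  then show ?thesis
    using c by (intro exI[of _ "1 / c"]) auto
qed

section \<open>Finiteness of the sharp constant\<close>

text \<open>This takes the \<open>p\<close>-th root. Positive \<open>i\<close> and \<open>j\<close>
  matter because the bases may be 0, where \<open>0 powr 0\<close> is 0 but \<open>0 ^ 0\<close> is
  1.\<close>

lemma powr_of_power_bound:
  fixes x a b C :: real
  assumes "x \<ge> 0" "a \<ge> 0" "b \<ge> 0" "C \<ge> 0" "p > 0" "i > 0" "j > 0"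
    and le: "x ^ p \<le> C * a ^ i * b ^ j"
  shows "x \<le> C powr (1 / p) * a powr (real i / p) * b powr (real j / p)"
proof -
  have "x = (x ^ p) powr (1 / p)"
    using assms(1,5) by (simp add: powr_realpow'[symmetric] powr_powr)
  also have "\<dots> \<le> (C * a ^ i * b ^ j) powr (1 / p)"
    using assms by (intro powr_mono2) auto
  also have "\<dots> = C powr (1 / p) * (a powr real i) powr (1 / p) * (b powr real j) powr (1 / p)"
    using assms by (simp add: powr_mult powr_realpow')
  finally show ?thesis
    by (simp add: powr_powr)
qed

text \<open>Since \<open>\<D>^n\<close> is bounded, the surplus power
  \<open>2 * (\<theta> - \<theta>0)\<close> of \<open>norm_D n u\<close> can be traded for the same
  power of \<open>l2_norm u\<close>.\<close>

lemma pointwise_bound_mono_theta: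
  fixes C \<theta>0 \<theta> :: real and n :: nat
  assumes "\<theta>0 \<le> \<theta>" "\<theta> < 1" "C \<ge> 0"
    and C: "\<forall>u::int ^ 'd::finite \<Rightarrow> real. u \<in> l2 \<longrightarrow>
      (\<forall>k. (u k)\<^sup>2 \<le> C * l2_norm u powr (2 * \<theta>0) * norm_D n u powr (2 * (1 - \<theta>0)))"
  shows "\<exists>C\<ge>0. \<forall>u::int ^ 'd \<Rightarrow> real. u \<in> l2 \<longrightarrow>
      (\<forall>k. (u k)\<^sup>2 \<le> C * l2_norm u powr (2 * \<theta>) * norm_D n u powr (2 * (1 - \<theta>)))"
proof -
  define c where "c = (2 * real CARD('d)) ^ n"
  define K where "K = C * c powr (2 * (\<theta> - \<theta>0))"
  have "(u k)\<^sup>2 \<le> K * l2_norm u powr (2 * \<theta>) * norm_D n u powr (2 * (1 - \<theta>))"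
    if u: "u \<in> l2" for u :: "int ^ 'd \<Rightarrow> real" and k
  proof -
    define a b where "a = l2_norm u" and "b = norm_D n u"
    have ab: "a \<ge> 0" "b \<ge> 0" "b \<le> c * a" "c > 0"
      using norm_D_le[OF u, of n] by (auto simp: a_def b_def c_def l2_norm_nonneg norm_D_nonneg)
    have le: "(u k)\<^sup>2 \<le> C * a powr (2 * \<theta>0) * b powr (2 * (1 - \<theta>0))"
      using C u by (simp add: a_def b_def)
    have "C * a powr (2 * \<theta>0) * b powr (2 * (1 - \<theta>0)) \<le> K * a powr (2 * \<theta>) * b powr (2 * (1 - \<theta>))"
    \<comment> \<open>For \<open>b = 0\<close> both sides are 0, because \<open>powr\<close> is 0 at
      base 0.\<close>
    proof (cases "b = 0")
      case False
      then have pos: "a > 0" "b > 0"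
        using ab by (auto simp: less_le)
      have "b powr (2 * (1 - \<theta>0)) = b powr (2 * (1 - \<theta>)) * b powr (2 * (\<theta> - \<theta>0))"
        by (simp add: powr_add[symmetric] algebra_simps)
      also have "\<dots> \<le> b powr (2 * (1 - \<theta>)) * (c * a) powr (2 * (\<theta> - \<theta>0))"
        using ab assms by (intro mult_left_mono powr_mono2) auto
      also have "\<dots> = b powr (2 * (1 - \<theta>)) * (c powr (2 * (\<theta> - \<theta>0)) * a powr (2 * (\<theta> - \<theta>0)))"
        using ab by (simp add: powr_mult)
      finally have "C * a powr (2 * \<theta>0) * b powr (2 * (1 - \<theta>0)) \<le> C * a powr (2 * \<theta>0)
          * (b powr (2 * (1 - \<theta>)) * (c powr (2 * (\<theta> - \<theta>0)) * a powr (2 * (\<theta> - \<theta>0))))"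
        using assms(3) by (intro mult_left_mono) auto
      also have "\<dots> = K * (a powr (2 * \<theta>0) * a powr (2 * (\<theta> - \<theta>0))) * b powr (2 * (1 - \<theta>))"
        by (simp add: K_def mult_ac)
      also have "a powr (2 * \<theta>0) * a powr (2 * (\<theta> - \<theta>0)) = a powr (2 * \<theta>)"
        by (simp add: powr_add[symmetric] algebra_simps)
      finally show ?thesis .
    qed (use assms in simp)
    with le show ?thesis
      by (simp add: a_def b_def)
  qed
  moreover have "K \<ge> 0"
    using assms(3) by (simp add: K_def)
  ultimately show ?thesis
    by blast
qed

text \<open>The \<open>n\<close>-th power of the bound along a line, with
  \<open>norm_D 1 u ^ n\<close> interpolated, is a multiple of \<open>a ^ (2 * n - 1) * b\<close>;
  its \<open>n\<close>-th root has the stated exponents.\<close>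

lemma pointwise_bound_line:
  assumes "n \<ge> 1"
  shows "\<exists>C\<ge>0. \<forall>u::int ^ 'd::finite \<Rightarrow> real. u \<in> l2 \<longrightarrow> (\<forall>k. (u k)\<^sup>2 \<le>
    C * l2_norm u powr (2 * (1 - 1 / (2 * real n))) * norm_D n u powr (2 * (1 - (1 - 1 / (2 * real n)))))"
proof -
  have "(u k)\<^sup>2 \<le> (4 ^ n) powr (1 / n) * l2_norm u powr (2 * (1 - 1 / (2 * real n)))
      * norm_D n u powr (2 * (1 - (1 - 1 / (2 * real n))))"
    if u: "u \<in> l2" for u :: "int ^ 'd \<Rightarrow> real" and k
  proof -
    define a b where "a = l2_norm u" and "b = norm_D n u"
    have nn: "a \<ge> 0" "b \<ge> 0"
      by (auto simp: a_def b_def l2_norm_nonneg norm_D_nonneg)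
    \<comment> \<open>\<open>undefined\<close> stands for an arbitrary coordinate direction.\<close>
    have "(u k)\<^sup>2 \<le> 4 * a * l2_norm (diff undefined u)"
      unfolding a_def by (rule power2_le_norm_diff[OF u])
    also have "\<dots> \<le> 4 * a * norm_D 1 u"
      unfolding norm_D_1 using nn by (intro mult_left_mono l2_norm_diff_le_grad) auto
    finally have "((u k)\<^sup>2) ^ n \<le> (4 * a * norm_D 1 u) ^ n"
      by (intro power_mono) auto
    also have "\<dots> = 4 ^ n * a ^ n * norm_D 1 u ^ n"
      by (simp only: power_mult_distrib)
    also have "\<dots> \<le> 4 ^ n * a ^ n * (a ^ (n - 1) * b)"
      unfolding a_def b_def
      by (intro mult_left_mono norm_D_interpolation u assms) (simp add: l2_norm_nonneg)
    also have "\<dots> = 4 ^ n * a ^ (n + (n - 1)) * b ^ 1"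
      by (simp add: power_add)
    finally have "(u k)\<^sup>2 \<le> (4 ^ n) powr (1 / n) * a powr (real (n + (n - 1)) / n) * b powr (real 1 / n)"
      using assms nn by (intro powr_of_power_bound) auto
    moreover have "real (n + (n - 1)) / n = 2 * (1 - 1 / (2 * real n))"
      "real 1 / n = 2 * (1 - (1 - 1 / (2 * real n)))"
      using assms by (auto simp: field_simps of_nat_diff)
    ultimately show ?thesis
      by (simp only: a_def b_def)
  qed
  then show ?thesis
    by (intro exI[of _ "(4 ^ n) powr (1 / n)"]) auto
qed

text \<open>This is the root of order \<open>Suc m\<close> of \<open>grad_power_bound\<close>;
  \<open>m \<ge> 1\<close> keeps the exponent of \<open>norm_D 1 u\<close> positive.\<close>

lemma pointwise_bound_plane:
  assumes "CARD('d::finite) \<ge> 2" "m \<ge> 1"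
  shows "\<exists>C\<ge>0. \<forall>u::int ^ 'd \<Rightarrow> real. u \<in> l2 \<longrightarrow> (\<forall>k. (u k)\<^sup>2 \<le>
    C * l2_norm u powr (2 * (1 / real (Suc m))) * norm_D 1 u powr (2 * (1 - 1 / real (Suc m))))"
proof -
  obtain C where C: "C \<ge> 0" "\<And>(u::int ^ 'd \<Rightarrow> real) k. u \<in> l2 \<Longrightarrow>
    (u k)\<^sup>2 ^ Suc m \<le> C * (l2_norm u) ^ 2 * (norm_D 1 u) ^ (2 * m)"
    using grad_power_bound[OF assms(1), of m] by blast
  have "(u k)\<^sup>2 \<le> C powr (1 / real (Suc m)) * l2_norm u powr (2 * (1 / real (Suc m)))
      * norm_D 1 u powr (2 * (1 - 1 / real (Suc m)))"
    if u: "u \<in> l2" for u :: "int ^ 'd \<Rightarrow> real" and k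
  proof -
    have "(u k)\<^sup>2 \<le> C powr (1 / real (Suc m)) * l2_norm u powr (real 2 / real (Suc m))
      * norm_D 1 u powr (real (2 * m) / real (Suc m))"
      using C u assms(2)
      by (intro powr_of_power_bound) (auto simp: l2_norm_nonneg norm_D_nonneg simp del: power_Suc)
    moreover have "real 2 / real (Suc m) = 2 * (1 / real (Suc m))"
      "real (2 * m) / real (Suc m) = 2 * (1 - 1 / real (Suc m))"
      by (auto simp: field_simps)
    ultimately show ?thesis
      by (simp only:)
  qed
  then show ?thesis
    by (intro exI[of _ "C powr (1 / real (Suc m))"]) auto
qed

lemma pointwise_bound_space:
  assumes "CARD('d::finite) \<ge> 3"
  shows "\<exists>C\<ge>0. \<forall>u::int ^ 'd \<Rightarrow> real. u \<in> l2 \<longrightarrow> (\<forall>k. (u k)\<^sup>2 \<le>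
    C * l2_norm u powr (2 * 0) * norm_D 1 u powr (2 * (1 - 0)))"
proof -
  obtain C where C: "C \<ge> 0" "\<And>(u::int ^ 'd \<Rightarrow> real) k. u \<in> l2 \<Longrightarrow> (u k)\<^sup>2 \<le> C * (norm_D 1 u)\<^sup>2"
    using grad_bound[OF assms] by blast
  have "(u k)\<^sup>2 \<le> C * l2_norm u powr (2 * 0) * norm_D 1 u powr (2 * (1 - 0))"
    if u: "u \<in> l2" for u :: "int ^ 'd \<Rightarrow> real" and k
  \<comment> \<open>If \<open>l2_norm u = 0\<close>, the convention \<open>0 powr 0 = 0\<close>
    makes the right side 0, but then \<open>u\<close> vanishes too.\<close>
  proof (cases "l2_norm u = 0")
    case True
    then show ?thesis
      using abs_le_l2_norm[OF u, of k] by simp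
  next
    case False
    have "norm_D 1 u powr real 2 = (norm_D 1 u)\<^sup>2"
      by (intro powr_realpow' norm_D_nonneg) simp
    then show ?thesis
      using C(2)[OF u, of k] False by simp
  qed
  then show ?thesis
    using C(1) by (intro exI[of _ C]) auto
qed

text \<open>One small exponent suffices in each case: the left endpoint for \<open>d = 1\<close> and
  \<open>d \<ge> 3\<close>, and some \<open>1 / real (Suc m) \<le> \<theta>\<close> for
  \<open>d = 2\<close>, where the interval is open at 0.\<close>

lemma pointwise_bound:
  fixes n :: nat and \<theta> :: real
  assumes "\<theta> < 1"
    and "(CARD('d) = 1 \<and> n \<ge> 1 \<and> \<theta> \<in> {1 - 1 / (2 * real n)..1})
       \<or> (CARD('d) = 2 \<and> n = 1 \<and> \<theta> \<in> {0<..1})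
       \<or> (CARD('d) \<ge> 3 \<and> n = 1 \<and> \<theta> \<in> {0..1})"
  shows "\<exists>C\<ge>0. \<forall>u::int ^ 'd::finite \<Rightarrow> real. u \<in> l2 \<longrightarrow>
      (\<forall>k. (u k)\<^sup>2 \<le> C * l2_norm u powr (2 * \<theta>) * norm_D n u powr (2 * (1 - \<theta>)))"
proof -
  from assms(2) consider "n \<ge> 1" "1 - 1 / (2 * real n) \<le> \<theta>"
    | "CARD('d) \<ge> 2" "n = 1" "\<theta> > 0" | "CARD('d) \<ge> 3" "n = 1" "\<theta> \<ge> 0"
    by force
  then show ?thesis
  proof cases
    case 1
    obtain C where C: "C \<ge> 0" "\<forall>u::int ^ 'd \<Rightarrow> real. u \<in> l2 \<longrightarrow> (\<forall>k. (u k)\<^sup>2 \<le>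
      C * l2_norm u powr (2 * (1 - 1 / (2 * real n))) * norm_D n u powr (2 * (1 - (1 - 1 / (2 * real n)))))"
      using pointwise_bound_line[OF 1(1)] by blast
    show ?thesis
      by (rule pointwise_bound_mono_theta[OF 1(2) assms(1) C])
  next
    case 2
    obtain m :: nat where m: "1 / \<theta> < real m"
      using reals_Archimedean2 by blast
    then have m1: "m \<ge> 1"
      using 2(3) by (cases m) (auto simp: divide_less_0_iff)
    have le: "1 / real (Suc m) \<le> \<theta>"
      using m 2(3) by (simp add: field_simps)
    obtain C where C: "C \<ge> 0" "\<forall>u::int ^ 'd \<Rightarrow> real. u \<in> l2 \<longrightarrow> (\<forall>k. (u k)\<^sup>2 \<le>
      C * l2_norm u powr (2 * (1 / real (Suc m))) * norm_D 1 u powr (2 * (1 - 1 / real (Suc m))))"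
      using pointwise_bound_plane[OF 2(1) m1] by blast
    show ?thesis
      unfolding 2(2) by (rule pointwise_bound_mono_theta[OF le assms(1) C])
  next
    case 3
    obtain C where C: "C \<ge> 0" "\<forall>u::int ^ 'd \<Rightarrow> real. u \<in> l2 \<longrightarrow> (\<forall>k. (u k)\<^sup>2 \<le>
      C * l2_norm u powr (2 * 0) * norm_D 1 u powr (2 * (1 - 0)))"
      using pointwise_bound_space[OF 3(1)] by blast
    show ?thesis
      unfolding 3(2) by (rule pointwise_bound_mono_theta[OF 3(3) assms(1) C])
  qed
qed

text \<open>The admissibility conditions are linear in \<open>C\<close>, hence survive passing to
  the infimum once the admissible set is nonempty and bounded below.\<close>

lemma sharp_const_bound:
  fixes n :: nat and \<theta> :: real
  assumes ex: "\<exists>C. \<forall>u::int ^ 'd::finite \<Rightarrow> real. u \<in> l2 \<longrightarrow>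
      (\<forall>k. (u k)\<^sup>2 \<le> C * l2_norm u powr (2 * \<theta>) * norm_D n u powr (2 * (1 - \<theta>)))"
  shows "sharp_const TYPE('d) n \<theta> \<ge> 0"
    and "\<And>(u::int ^ 'd \<Rightarrow> real) k. u \<in> l2 \<Longrightarrow>
      (u k)\<^sup>2 \<le> sharp_const TYPE('d) n \<theta> * l2_norm u powr (2 * \<theta>) * norm_D n u powr (2 * (1 - \<theta>))"
proof -
  define S where "S = {C. \<forall>u \<in> (l2 :: (int ^ 'd \<Rightarrow> real) set).
     (SUP k. (u k)\<^sup>2) \<le> C * l2_norm u powr (2 * \<theta>) * norm_D n u powr (2 * (1 - \<theta>))}"
  have pointwise: "(u k)\<^sup>2 \<le> C * l2_norm u powr (2 * \<theta>) * norm_D n u powr (2 * (1 - \<theta>))"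
    if "C \<in> S" "u \<in> l2" for C k and u :: "int ^ 'd \<Rightarrow> real"
  proof -
    \<comment> \<open>Boundedness of \<open>u\<close> makes the real supremum an actual upper
      bound.\<close>
    have "bdd_above (range (\<lambda>k. (u k)\<^sup>2))"
    proof (rule bdd_aboveI2)
      show "(u k)\<^sup>2 \<le> (l2_norm u)\<^sup>2" for k
        using abs_le_l2_norm[OF that(2), of k] by (simp add: abs_le_square_iff[symmetric] l2_norm_nonneg)
    qed
    then have "(u k)\<^sup>2 \<le> (SUP k. (u k)\<^sup>2)"
      by (rule cSUP_upper[OF UNIV_I])
    then show ?thesis
      using that by (force simp: S_def)
  qed
  have "S \<noteq> {}"
  proof -
    obtain C where "\<forall>u::int ^ 'd \<Rightarrow> real. u \<in> l2 \<longrightarrow>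
      (\<forall>k. (u k)\<^sup>2 \<le> C * l2_norm u powr (2 * \<theta>) * norm_D n u powr (2 * (1 - \<theta>)))"
      using ex by blast
    then have "C \<in> S"
      unfolding S_def by (auto intro!: cSUP_least)
    then show ?thesis
      by blast
  qed
  have nonneg: "C \<ge> 0" if "C \<in> S" for C
  proof (rule ccontr)
    assume "\<not> C \<ge> 0"
    \<comment> \<open>A unit mass at the origin rules out negative constants.\<close>
    define \<delta> :: "int ^ 'd \<Rightarrow> real" where "\<delta> = (\<lambda>k. if k = 0 then 1 else 0)"
    have "(\<lambda>k. (\<delta> k)\<^sup>2) summable_on UNIV"
      by (rule finite_nonzero_values_imp_summable_on) (simp add: \<delta>_def)
    then have "(\<delta> 0)\<^sup>2 \<le> C * l2_norm \<delta> powr (2 * \<theta>) * norm_D n \<delta> powr (2 * (1 - \<theta>))"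
      by (intro pointwise that) (simp add: l2_def)
    also have "\<dots> \<le> 0"
      using \<open>\<not> C \<ge> 0\<close> by (intro mult_nonpos_nonneg) auto
    finally show False
      by (simp add: \<delta>_def)
  qed
  have K: "sharp_const TYPE('d) n \<theta> = Inf S"
    by (simp add: sharp_const_def S_def)
  show "sharp_const TYPE('d) n \<theta> \<ge> 0"
    unfolding K using \<open>S \<noteq> {}\<close> nonneg by (rule cInf_greatest)
  fix u :: "int ^ 'd \<Rightarrow> real" and k
  assume u: "u \<in> l2"
  define X where "X = l2_norm u powr (2 * \<theta>) * norm_D n u powr (2 * (1 - \<theta>))"
  have le: "(u k)\<^sup>2 \<le> C * X" if "C \<in> S" for C
    using pointwise[OF that u, of k] by (simp add: X_def mult.assoc)
  have "(u k)\<^sup>2 \<le> Inf S * X"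
  \<comment> \<open>For \<open>X = 0\<close> any admissible constant already gives
    \<open>u k = 0\<close>; otherwise one divides by \<open>X\<close>.\<close>
  proof (cases "X = 0")
    case True
    then show ?thesis
      using \<open>S \<noteq> {}\<close> le by fastforce
  next
    case False
    then have "X > 0"
      by (simp add: X_def)
    then have "(u k)\<^sup>2 / X \<le> Inf S"
      using le \<open>S \<noteq> {}\<close> by (intro cInf_greatest) (auto simp: divide_le_eq)
    then show ?thesis
      using \<open>X > 0\<close> by (simp add: divide_le_eq)
  qed
  then show "(u k)\<^sup>2 \<le> sharp_const TYPE('d) n \<theta> * l2_norm u powr (2 * \<theta>) * norm_D n u powr (2 * (1 - \<theta>))"
    by (simp add: K X_def mult.assoc)
qed

section \<open>Orthonormal families\<close>

lemma l2_norm_sq_combination: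
  assumes "\<And>j. j \<in> J \<Longrightarrow> f j \<in> l2"
  shows "(l2_norm (\<lambda>k. \<Sum>j\<in>J. \<xi> j * f j k))\<^sup>2 = (\<Sum>i\<in>J. \<Sum>j\<in>J. \<xi> i * \<xi> j * l2_inner (f i) (f j))"
proof -
  have "((\<lambda>k. \<Sum>i\<in>J. \<Sum>j\<in>J. \<xi> i * \<xi> j * (f i k * f j k)) has_sum
      (\<Sum>i\<in>J. \<Sum>j\<in>J. \<xi> i * \<xi> j * l2_inner (f i) (f j))) UNIV"
    unfolding l2_inner_def
    by (intro has_sum_sum_real has_sum_cmult_right has_sum_infsum l2_mult_summable assms)
  moreover have "(\<Sum>j\<in>J. \<xi> j * f j k)\<^sup>2 = (\<Sum>i\<in>J. \<Sum>j\<in>J. \<xi> i * \<xi> j * (f i k * f j k))" for k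
    by (simp add: power2_eq_square sum_product mult_ac)
  ultimately show ?thesis
    unfolding l2_norm_sq_infsum by (auto intro: infsumI)
qed

lemma diff_combination:
  "diff i (\<lambda>k. \<Sum>j\<in>J. \<xi> j * f j k) = (\<lambda>k. \<Sum>j\<in>J. \<xi> j * diff i (f j) k)"
  by (simp add: diff_def[abs_def] sum_subtractf right_diff_distrib)

lemma laplace_combination:
  "laplace (\<lambda>k. \<Sum>j\<in>J. \<xi> j * f j k) = (\<lambda>k. \<Sum>j\<in>J. \<xi> j * laplace (f j) k)"
proof
  fix k
  have "laplace (\<lambda>k. \<Sum>j\<in>J. \<xi> j * f j k) k
      = - (\<Sum>i\<in>UNIV. \<Sum>j\<in>J. \<xi> j * (2 * f j k - f j (k + axis i 1) - f j (k - axis i 1)))"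
    unfolding laplace_eq
    by (simp add: sum_subtractf right_diff_distrib sum_distrib_left mult.left_commute)
  also have "\<dots> = (\<Sum>j\<in>J. \<xi> j * laplace (f j) k)"
    by (subst sum.swap) (simp add: laplace_eq sum_distrib_left sum_negf)
  finally show "laplace (\<lambda>k. \<Sum>j\<in>J. \<xi> j * f j k) k = (\<Sum>j\<in>J. \<xi> j * laplace (f j) k)" .
qed

lemma laplace_power_combination:
  "(laplace ^^ m) (\<lambda>k. \<Sum>j\<in>J. \<xi> j * f j k) = (\<lambda>k. \<Sum>j\<in>J. \<xi> j * (laplace ^^ m) (f j) k)"
  by (induction m) (auto simp: laplace_combination)

text \<open>\<open>B\<close> is the Gram matrix of the family \<open>\<D>^n u_j\<close>. Recording
  only its diagonal and its quadratic form hides whether \<open>\<D>^n\<close> is scalar or vector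
  valued.\<close>

lemma norm_D_sq_combination:
  fixes u :: "'j \<Rightarrow> int ^ 'd::finite \<Rightarrow> real"
  assumes u: "\<And>j. j \<in> J \<Longrightarrow> u j \<in> l2"
  shows "\<exists>B. (\<forall>j. B j j = (norm_D n (u j))\<^sup>2) \<and>
    (\<forall>\<xi>. (norm_D n (\<lambda>k. \<Sum>j\<in>J. \<xi> j * u j k))\<^sup>2 = (\<Sum>i\<in>J. \<Sum>j\<in>J. \<xi> i * \<xi> j * B i j))"
proof (cases "even n")
  case True
  let ?f = "\<lambda>j. (laplace ^^ (n div 2)) (u j)"
  show ?thesis
  proof (intro exI[of _ "\<lambda>i j. l2_inner (?f i) (?f j)"] conjI allI)
    show "l2_inner (?f j) (?f j) = (norm_D n (u j))\<^sup>2" for j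
      using True by (simp add: norm_D_def l2_norm_sq)
    show "(norm_D n (\<lambda>k. \<Sum>j\<in>J. \<xi> j * u j k))\<^sup>2 = (\<Sum>i\<in>J. \<Sum>j\<in>J. \<xi> i * \<xi> j * l2_inner (?f i) (?f j))" for \<xi>
      using True l2_norm_sq_combination[of J ?f \<xi>] u
      by (simp add: norm_D_def laplace_power_combination l2_laplace_power)
  qed
next
  case False
  let ?f = "\<lambda>l j. diff l ((laplace ^^ ((n - 1) div 2)) (u j))"
  show ?thesis
  proof (intro exI[of _ "\<lambda>i j. \<Sum>l\<in>UNIV. l2_inner (?f l i) (?f l j)"] conjI allI)
    show "(\<Sum>l\<in>UNIV. l2_inner (?f l j) (?f l j)) = (norm_D n (u j))\<^sup>2" for j
      using False by (simp add: norm_D_def l2_norm_vec_sq grad_def l2_norm_sq)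
    show "(norm_D n (\<lambda>k. \<Sum>j\<in>J. \<xi> j * u j k))\<^sup>2
        = (\<Sum>i\<in>J. \<Sum>j\<in>J. \<xi> i * \<xi> j * (\<Sum>l\<in>UNIV. l2_inner (?f l i) (?f l j)))" for \<xi>
    proof -
      have "(norm_D n (\<lambda>k. \<Sum>j\<in>J. \<xi> j * u j k))\<^sup>2 = (\<Sum>l\<in>UNIV. (l2_norm (\<lambda>k. \<Sum>j\<in>J. \<xi> j * ?f l j k))\<^sup>2)"
        using False
        by (simp add: norm_D_def l2_norm_vec_sq grad_def laplace_power_combination diff_combination)
      also have "\<dots> = (\<Sum>l\<in>UNIV. \<Sum>i\<in>J. \<Sum>j\<in>J. \<xi> i * \<xi> j * l2_inner (?f l i) (?f l j))"
        by (intro sum.cong refl l2_norm_sq_combination l2_diff l2_laplace_power u)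
      also have "\<dots> = (\<Sum>i\<in>J. \<Sum>j\<in>J. \<Sum>l\<in>UNIV. \<xi> i * \<xi> j * l2_inner (?f l i) (?f l j))"
        by (subst sum.swap) (intro sum.cong refl sum.swap)
      finally show ?thesis
        by (simp add: sum_distrib_left)
    qed
  qed
qed

section \<open>Summation of the pointwise bound over the lattice\<close>

theorem theorem6p3:
  fixes u :: "nat \<Rightarrow> int ^ 'd::finite \<Rightarrow> real"
    and \<rho> :: "int ^ 'd \<Rightarrow> real"
    and n N :: nat and \<theta> :: real
  assumes "\<theta> < 1"
    and "(CARD('d) = 1 \<and> n \<ge> 1 \<and> \<theta> \<in> {1 - 1 / (2 * real n)..1})
       \<or> (CARD('d) = 2 \<and> n = 1 \<and> \<theta> \<in> {0<..1})
       \<or> (CARD('d) \<ge> 3 \<and> n = 1 \<and> \<theta> \<in> {0..1})"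
    and "\<And>j. j \<in> {1..N} \<Longrightarrow> u j \<in> l2"
    and "\<And>i j. i \<in> {1..N} \<Longrightarrow> j \<in> {1..N} \<Longrightarrow> l2_inner (u i) (u j) = (if i = j then 1 else 0)"
    and "\<And>k. \<rho> k = (\<Sum>j=1..N. (u j k)\<^sup>2)"
  shows "(\<lambda>k. \<rho> k powr ((2 - \<theta>) / (1 - \<theta>))) summable_on UNIV
    \<and> (\<Sum>\<^sub>\<infinity>k. \<rho> k powr ((2 - \<theta>) / (1 - \<theta>)))
        \<le> sharp_const TYPE('d) n \<theta> powr (1 / (1 - \<theta>)) * (\<Sum>j=1..N. (norm_D n (u j))\<^sup>2)"
proof -
  let ?J = "{1..N}"
  define K where "K = sharp_const TYPE('d) n \<theta>"
  note \<theta> = assms(1) and u = assms(3) and orth = assms(4) and rho = assms(5)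
  have "\<exists>C. \<forall>u::int ^ 'd \<Rightarrow> real. u \<in> l2 \<longrightarrow>
      (\<forall>k. (u k)\<^sup>2 \<le> C * l2_norm u powr (2 * \<theta>) * norm_D n u powr (2 * (1 - \<theta>)))"
    using pointwise_bound[OF assms(1,2)] by blast
  note K = sharp_const_bound[OF this, folded K_def]
  obtain B where B: "\<And>j. B j j = (norm_D n (u j))\<^sup>2"
    "\<And>\<xi>. (norm_D n (\<lambda>k. \<Sum>j\<in>?J. \<xi> j * u j k))\<^sup>2 = (\<Sum>i\<in>?J. \<Sum>j\<in>?J. \<xi> i * \<xi> j * B i j)"
    using norm_D_sq_combination[of ?J u n, OF u] by blast
  \<comment> \<open>Written as a quadratic form in the numbers \<open>u j k\<close>, this can be
    summed over \<open>k\<close> entry by entry.\<close>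
  define q where "q k = (\<Sum>i\<in>?J. \<Sum>j\<in>?J. u i k * u j k * B i j)" for k
  have q_eq: "q k = (norm_D n (\<lambda>l. \<Sum>j\<in>?J. u j k * u j l))\<^sup>2" for k
    unfolding q_def using B(2)[of "\<lambda>j. u j k"] by simp
  have le: "\<rho> k powr ((2 - \<theta>) / (1 - \<theta>)) \<le> K powr (1 / (1 - \<theta>)) * q k" for k
  proof (cases "\<rho> k = 0")
    case True
    then show ?thesis
      by (simp add: q_eq)
  next
    case False
    moreover have "\<rho> k \<ge> 0"
      by (simp add: rho sum_nonneg)
    ultimately have pos: "\<rho> k > 0"
      by simp
    \<comment> \<open>\<open>v\<close> is the orthogonal projection of the unit mass at
      \<open>k\<close> onto the span of the family, whence
      \<open>v k = \<parallel>v\<parallel>^2 = \<rho> k\<close>.\<close>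
    define v where "v = (\<lambda>l. \<Sum>j\<in>?J. u j k * u j l)"
    define D where "D = norm_D n v"
    have v: "v \<in> l2"
      unfolding v_def by (intro l2_sum l2_cmult u)
    have "v k = \<rho> k"
      by (simp add: v_def rho power2_eq_square)
    have "(l2_norm v)\<^sup>2 = (\<Sum>i\<in>?J. \<Sum>j\<in>?J. u i k * u j k * l2_inner (u i) (u j))"
      unfolding v_def by (rule l2_norm_sq_combination[OF u])
    also have "\<dots> = (\<Sum>i\<in>?J. \<Sum>j\<in>?J. if i = j then u i k * u j k else 0)"
      by (intro sum.cong refl) (simp add: orth)
    also have "\<dots> = \<rho> k"
      by (simp add: rho power2_eq_square)
    finally have "l2_norm v = sqrt (\<rho> k)"
      by (metis l2_norm_nonneg real_sqrt_unique)
    then have "l2_norm v powr (2 * \<theta>) = \<rho> k powr \<theta>"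
      using pos by (simp add: powr_half_sqrt[symmetric] powr_powr)
    with K(2)[OF v, of k] have "(\<rho> k)\<^sup>2 \<le> K * \<rho> k powr \<theta> * D powr (2 * (1 - \<theta>))"
      by (simp add: \<open>v k = \<rho> k\<close> D_def)
    \<comment> \<open>Dividing by \<open>\<rho> k powr \<theta>\<close> and taking the power
      \<open>1 / (1 - \<theta>)\<close> turns the exponent of \<open>D\<close> into 2, which matches
      the quadratic form.\<close>
    then have "\<rho> k powr 2 / \<rho> k powr \<theta> \<le> K * D powr (2 * (1 - \<theta>))"
      using pos by (simp add: divide_le_eq mult_ac)
    then have "\<rho> k powr (2 - \<theta>) \<le> K * D powr (2 * (1 - \<theta>))"
      using pos by (simp add: powr_diff)
    then have "(\<rho> k powr (2 - \<theta>)) powr (1 / (1 - \<theta>)) \<le> (K * D powr (2 * (1 - \<theta>))) powr (1 / (1 - \<theta>))"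
      using \<theta> by (intro powr_mono2) auto
    also have "\<dots> = K powr (1 / (1 - \<theta>)) * D powr real 2"
    proof -
      have "2 * (1 - \<theta>) * (1 / (1 - \<theta>)) = real 2"
        using \<theta> by (simp add: divide_eq_eq)
      then have "(D powr (2 * (1 - \<theta>))) powr (1 / (1 - \<theta>)) = D powr real 2"
        by (simp only: powr_powr)
      moreover have "(K * D powr (2 * (1 - \<theta>))) powr (1 / (1 - \<theta>))
          = K powr (1 / (1 - \<theta>)) * (D powr (2 * (1 - \<theta>))) powr (1 / (1 - \<theta>))"
        by (rule powr_mult)
      ultimately show ?thesis
        by (simp only:)
    qed
    also have "D powr real 2 = q k"
      unfolding q_eq D_def v_def by (intro powr_realpow' norm_D_nonneg) simp
    finally show ?thesis
      by (simp add: powr_powr)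
  qed
  \<comment> \<open>Summing over \<open>k\<close> turns the products \<open>u i k * u j k\<close>
    into inner products, and orthonormality leaves the trace of \<open>B\<close>.\<close>
  have "(q has_sum (\<Sum>i\<in>?J. \<Sum>j\<in>?J. l2_inner (u i) (u j) * B i j)) UNIV"
    unfolding q_def l2_inner_def
    by (intro has_sum_sum_real has_sum_cmult_left has_sum_infsum l2_mult_summable u)
  also have "(\<Sum>i\<in>?J. \<Sum>j\<in>?J. l2_inner (u i) (u j) * B i j) = (\<Sum>i\<in>?J. \<Sum>j\<in>?J. if i = j then B i j else 0)"
    by (intro sum.cong refl) (simp add: orth)
  also have "\<dots> = (\<Sum>j=1..N. (norm_D n (u j))\<^sup>2)"
    by (simp add: B(1))
  finally have sum: "((\<lambda>k. K powr (1 / (1 - \<theta>)) * q k) has_sum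
      K powr (1 / (1 - \<theta>)) * (\<Sum>j=1..N. (norm_D n (u j))\<^sup>2)) UNIV"
    by (rule has_sum_cmult_right)
  have summable: "(\<lambda>k. \<rho> k powr ((2 - \<theta>) / (1 - \<theta>))) summable_on UNIV"
    using le by (intro summable_on_comparison_test[OF has_sum_imp_summable[OF sum]]) auto
  moreover have "(\<Sum>\<^sub>\<infinity>k. \<rho> k powr ((2 - \<theta>) / (1 - \<theta>)))
      \<le> K powr (1 / (1 - \<theta>)) * (\<Sum>j=1..N. (norm_D n (u j))\<^sup>2)"
    by (rule has_sum_mono[OF has_sum_infsum[OF summable] sum]) (rule le)
  ultimately show ?thesis
    by (simp add: K_def)
qed

end
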